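(* Let $\mathbf{k}$ be a field of characteristic different from $2$ and $3$, $\mathfrak{g}$ a Lie algebra over $\mathbf{k}$, and $M$ a representation of $\mathfrak{g}$. The skew-symmetrization functor induces a map $$\mathrm{ss}:HL^3_{\mathrm{Lie}}(\mathfrak{g},M)\longrightarrow H^3(\mathfrak{g},M)$$ onto the Chevalley--Eilenberg cohomology, fitting into the exact sequence $$0\longrightarrow\mathrm{Hom}(\wedge^2\mathfrak{a},M)\stackrel{\iota}{\longrightarrow}HL^3_{\mathrm{Lie}}(\mathfrak{g},M)\stackrel{\mathrm{ss}}{\longrightarrow}H^3(\mathfrak{g},M)\longrightarrow0,$$ where $\mathfrak{a}=\mathfrak{g}/[\mathfrak{g},\mathfrak{g}]$ is the abelianization and $\iota(a)=[(a,0)]$. A canonical splitting is given by $\phi\mapsto[(0,\phi)]$.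
   Context: For a Lie algebra $\mathfrak{g}$ and a representation $M$, write $[x,m]=x\cdot m$ and $[m,x]=-x\cdot m$. $ZL^3_{\mathrm{Lie}}(\mathfrak{g},M)$ is the space of pairs $(s,j)$ of linear maps $s:\mathfrak{g}^{\otimes2}\to M$, $j:\mathfrak{g}^{\otimes3}\to M$ such that for all $x,y,z,w\in\mathfrak{g}$ $[x,j(y,z,w)]-[y,j(x,z,w)]+[z,j(x,y,w)]+[j(x,y,z),w]-j([x,y],z,w)-j(y,[x,z],w)-j(y,z,[x,w])+j(x,[y,z],w)+j(x,z,[y,w])-j(x,y,[z,w])=0$; $j(x,y,z)+j(y,x,z)=[z,s(x,y)]$; $j(x,y,z)+j(x,z,y)=[x,s(y,z)]-s([x,y],z)-s(y,[x,z])$; $s([x,y],z)=s(z,[x,y])$. $BL^3_{\mathrm{Lie}}(\mathfrak{g},M)\subseteq ZL^3_{\mathrm{Lie}}(\mathfrak{g},M)$ is the subspace of pairs $(s,j)$ for which there is a linear $f:\mathfrak{g}^{\otimes2}\to M$ with $s(x,y)=f(x,y)+f(y,x)$ and $j(x,y,z)=[x,f(y,z)]-[y,f(x,z)]-[f(x,y),z]-f([x,y],z)-f(y,[x,z])+f(x,[y,z])$. $HL^3_{\mathrm{Lie}}(\mathfrak{g},M)=ZL^3_{\mathrm{Lie}}(\mathfrak{g},M)/BL^3_{\mathrm{Lie}}(\mathfrak{g},M)$, and $[(s,j)]$ denotes the class of $(s,j)$. Pairs $(s,j)\in ZL^3_{\mathrm{Lie}}(\mathfrak{g},M)$ are the (alternator,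 Jacobiator) data of skeletal Lie 2-algebras with underlying Lie algebra $\mathfrak{g}$ and module $M$. Skew-symmetrization replaces $(s,j)$ by $(0,\bar\jmath)$ with $$\bar\jmath(x_1,x_2,x_3)=\tfrac16\sum_{\sigma\in S_3}(-1)^\sigma j(x_{\sigma(1)},x_{\sigma(2)},x_{\sigma(3)})-\tfrac1{12}\sum_{\sigma\in S_3}(-1)^\sigma s([x_{\sigma(1)},x_{\sigma(2)}],x_{\sigma(3)}),$$ and $\mathrm{ss}$ sends $[(s,j)]$ to the Chevalley--Eilenberg class of $\bar\jmath$. An element $a\in\mathrm{Hom}(\wedge^2\mathfrak{a},M)$ is regarded as a bilinear map on $\mathfrak{g}$ via the projection $\mathfrak{g}\to\mathfrak{a}$; in the splitting, $\phi$ is a Chevalley--Eilenberg 3-cocycle representing a class in $H^3(\mathfrak{g},M)$.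
   Formalization: Hom(∧²𝔞, M) is taken to be the 𝔤-equivariant maps, i.e. linear maps into the invariants M^𝔤: for other linear a the pair (a,0) is not in ZL³, so ι(a) is undefined; for trivial action on M this is all linear maps. *)

theory Defs
  imports
    "HOL-Computational_Algebra.Computational_Algebra"
    "HOL-Combinatorics.Permutations"
    "HOL-Library.Function_Algebras"
    "HOL-Library.Product_Plus"
    "HOL-Library.Set_Algebras"
begin

section \<open>Quotient spaces and linear maps between them\<close>

text \<open>
  Vector spaces are given by a scalar multiplication on a type of class
  \<open>ab_group_add\<close>, as in \<open>Vector_Spaces\<close>.  Cochains are curried functions, added pointwise; a
  linear map out of a tensor power is given as a multilinear function.
\<close>

definition fun_scale :: "('k \<Rightarrow> 'v \<Rightarrow> 'v) \<Rightarrow> 'k \<Rightarrow> ('a \<Rightarrow> 'v) \<Rightarrow> ('a \<Rightarrow> 'v)" where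
  "fun_scale sc c f = (\<lambda>x. sc c (f x))"

definition prod_scale ::
    "('k \<Rightarrow> 'v \<Rightarrow> 'v) \<Rightarrow> ('k \<Rightarrow> 'w \<Rightarrow> 'w) \<Rightarrow> 'k \<Rightarrow> 'v \<times> 'w \<Rightarrow> 'v \<times> 'w" where
  "prod_scale s1 s2 c p = (s1 c (fst p), s2 c (snd p))"

text \<open>
  For subspaces \<open>U \<subseteq> Z\<close>, the elements of \<open>Z/U\<close> are the cosets \<open>v +o U\<close>.  Cosets are added by the
  elementwise sum of sets.  The zero of \<open>Z/U\<close> is \<open>U\<close> itself (not the \<open>0\<close> of the type of sets, which
  is \<open>{0}\<close>).  Adding \<open>U\<close> in \<open>quot_scale\<close> only matters for the scalar \<open>0\<close>.
\<close>

definition quot :: "'v::plus set \<Rightarrow> 'v set \<Rightarrow> 'v set set" where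
  "quot Z U = (\<lambda>v. v +o U) ` Z"

definition quot_scale :: "('k \<Rightarrow> 'v \<Rightarrow> 'v) \<Rightarrow> 'v::plus set \<Rightarrow> 'k \<Rightarrow> 'v set \<Rightarrow> 'v set" where
  "quot_scale sc U c C = sc c ` C + U"

definition linear_on ::
    "('k \<Rightarrow> 'v::plus \<Rightarrow> 'v) \<Rightarrow> ('k \<Rightarrow> 'w::plus \<Rightarrow> 'w) \<Rightarrow> 'v set \<Rightarrow> 'w set \<Rightarrow> ('v \<Rightarrow> 'w) \<Rightarrow> bool" where
  "linear_on sV sW V W f \<longleftrightarrow>
     (\<forall>x\<in>V. f x \<in> W) \<and>
     (\<forall>x\<in>V. \<forall>y\<in>V. f (x + y) = f x + f y) \<and>
     (\<forall>c. \<forall>x\<in>V. f (sV c x) = sW c (f x))"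

text \<open>
  The map on cosets induced by a map \<open>F\<close> on representatives with values in a quotient.  It is
  meaningful only if \<open>F\<close> is constant on each coset.
\<close>

definition induced :: "('v \<Rightarrow> 'w) \<Rightarrow> 'v set \<Rightarrow> 'w" where
  "induced F C = the_elem (F ` C)"

section \<open>Lie algebras and representations\<close>

definition bilinear_map ::
    "('k::field \<Rightarrow> 'u::ab_group_add \<Rightarrow> 'u) \<Rightarrow> ('k \<Rightarrow> 'v::ab_group_add \<Rightarrow> 'v) \<Rightarrow>
     ('k \<Rightarrow> 'w::ab_group_add \<Rightarrow> 'w) \<Rightarrow> ('u \<Rightarrow> 'v \<Rightarrow> 'w) \<Rightarrow> bool" where
  "bilinear_map s1 s2 s3 f \<longleftrightarrow>
     (\<forall>x. Vector_Spaces.linear s2 s3 (\<lambda>y. f x y)) \<and>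
     (\<forall>y. Vector_Spaces.linear s1 s3 (\<lambda>x. f x y))"

definition trilinear_map ::
    "('k::field \<Rightarrow> 'u::ab_group_add \<Rightarrow> 'u) \<Rightarrow> ('k \<Rightarrow> 'w::ab_group_add \<Rightarrow> 'w) \<Rightarrow>
     ('u \<Rightarrow> 'u \<Rightarrow> 'u \<Rightarrow> 'w) \<Rightarrow> bool" where
  "trilinear_map s1 s2 f \<longleftrightarrow>
     (\<forall>y z. Vector_Spaces.linear s1 s2 (\<lambda>x. f x y z)) \<and>
     (\<forall>x z. Vector_Spaces.linear s1 s2 (\<lambda>y. f x y z)) \<and>
     (\<forall>x y. Vector_Spaces.linear s1 s2 (\<lambda>z. f x y z))"

locale lie_algebra = vector_space scg
  for scg :: "'k::field \<Rightarrow> 'g::ab_group_add \<Rightarrow> 'g" +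
  fixes br :: "'g \<Rightarrow> 'g \<Rightarrow> 'g"
  assumes br_bilinear: "bilinear_map scg scg scg br"
    and br_self: "br x x = 0"
    and jacobi: "br x (br y z) + br y (br z x) + br z (br x y) = 0"

locale lie_representation = lie_algebra scg br + M: vector_space scm
  for scg :: "'k::field \<Rightarrow> 'g::ab_group_add \<Rightarrow> 'g"
    and br :: "'g \<Rightarrow> 'g \<Rightarrow> 'g"
    and scm :: "'k \<Rightarrow> 'm::ab_group_add \<Rightarrow> 'm" +
  fixes act :: "'g \<Rightarrow> 'm \<Rightarrow> 'm"
  assumes act_bilinear: "bilinear_map scg scm scm act"
    and act_br: "act (br x y) m = act x (act y m) - act y (act x m)"

section \<open>The spaces \<open>ZL\<^sup>3\<close>, \<open>BL\<^sup>3\<close> and \<open>HL\<^sup>3\<close>\<close>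

text \<open>Throughout, \<open>[x, m] = act x m\<close> and \<open>[m, x] = - act x m\<close>.\<close>

definition ZL3 ::
    "('k::field \<Rightarrow> 'g::ab_group_add \<Rightarrow> 'g) \<Rightarrow> ('g \<Rightarrow> 'g \<Rightarrow> 'g) \<Rightarrow>
     ('k \<Rightarrow> 'm::ab_group_add \<Rightarrow> 'm) \<Rightarrow> ('g \<Rightarrow> 'm \<Rightarrow> 'm) \<Rightarrow>
     (('g \<Rightarrow> 'g \<Rightarrow> 'm) \<times> ('g \<Rightarrow> 'g \<Rightarrow> 'g \<Rightarrow> 'm)) set" where
  "ZL3 scg br scm act = {(s, j).
     bilinear_map scg scg scm s \<and> trilinear_map scg scm j \<and>
     (\<forall>x y z w. act x (j y z w) - act y (j x z w) + act z (j x y w) + (- act w (j x y z))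
        - j (br x y) z w - j y (br x z) w - j y z (br x w)
        + j x (br y z) w + j x z (br y w) - j x y (br z w) = 0) \<and>
     (\<forall>x y z. j x y z + j y x z = act z (s x y)) \<and>
     (\<forall>x y z. j x y z + j x z y = act x (s y z) - s (br x y) z - s y (br x z)) \<and>
     (\<forall>x y z. s (br x y) z = s z (br x y))}"

definition BL3 ::
    "('k::field \<Rightarrow> 'g::ab_group_add \<Rightarrow> 'g) \<Rightarrow> ('g \<Rightarrow> 'g \<Rightarrow> 'g) \<Rightarrow>
     ('k \<Rightarrow> 'm::ab_group_add \<Rightarrow> 'm) \<Rightarrow> ('g \<Rightarrow> 'm \<Rightarrow> 'm) \<Rightarrow>
     (('g \<Rightarrow> 'g \<Rightarrow> 'm) \<times> ('g \<Rightarrow> 'g \<Rightarrow> 'g \<Rightarrow> 'm)) set" where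
  "BL3 scg br scm act = {(s, j). (s, j) \<in> ZL3 scg br scm act \<and>
     (\<exists>f. bilinear_map scg scg scm f \<and>
        (\<forall>x y. s x y = f x y + f y x) \<and>
        (\<forall>x y z. j x y z = act x (f y z) - act y (f x z) - (- act z (f x y))
           - f (br x y) z - f y (br x z) + f x (br y z)))}"

definition HL3 ::
    "('k::field \<Rightarrow> 'g::ab_group_add \<Rightarrow> 'g) \<Rightarrow> ('g \<Rightarrow> 'g \<Rightarrow> 'g) \<Rightarrow>
     ('k \<Rightarrow> 'm::ab_group_add \<Rightarrow> 'm) \<Rightarrow> ('g \<Rightarrow> 'm \<Rightarrow> 'm) \<Rightarrow>
     (('g \<Rightarrow> 'g \<Rightarrow> 'm) \<times> ('g \<Rightarrow> 'g \<Rightarrow> 'g \<Rightarrow> 'm)) set set" where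
  "HL3 scg br scm act = quot (ZL3 scg br scm act) (BL3 scg br scm act)"

definition HL3_class ::
    "('k::field \<Rightarrow> 'g::ab_group_add \<Rightarrow> 'g) \<Rightarrow> ('g \<Rightarrow> 'g \<Rightarrow> 'g) \<Rightarrow>
     ('k \<Rightarrow> 'm::ab_group_add \<Rightarrow> 'm) \<Rightarrow> ('g \<Rightarrow> 'm \<Rightarrow> 'm) \<Rightarrow>
     ('g \<Rightarrow> 'g \<Rightarrow> 'm) \<times> ('g \<Rightarrow> 'g \<Rightarrow> 'g \<Rightarrow> 'm) \<Rightarrow>
     (('g \<Rightarrow> 'g \<Rightarrow> 'm) \<times> ('g \<Rightarrow> 'g \<Rightarrow> 'g \<Rightarrow> 'm)) set" where
  "HL3_class scg br scm act p = p +o BL3 scg br scm act"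

definition HL3_scale ::
    "('k::field \<Rightarrow> 'g::ab_group_add \<Rightarrow> 'g) \<Rightarrow> ('g \<Rightarrow> 'g \<Rightarrow> 'g) \<Rightarrow>
     ('k \<Rightarrow> 'm::ab_group_add \<Rightarrow> 'm) \<Rightarrow> ('g \<Rightarrow> 'm \<Rightarrow> 'm) \<Rightarrow> 'k \<Rightarrow>
     (('g \<Rightarrow> 'g \<Rightarrow> 'm) \<times> ('g \<Rightarrow> 'g \<Rightarrow> 'g \<Rightarrow> 'm)) set \<Rightarrow>
     (('g \<Rightarrow> 'g \<Rightarrow> 'm) \<times> ('g \<Rightarrow> 'g \<Rightarrow> 'g \<Rightarrow> 'm)) set" where
  "HL3_scale scg br scm act =
     quot_scale (prod_scale (fun_scale (fun_scale scm)) (fun_scale (fun_scale (fun_scale scm))))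
       (BL3 scg br scm act)"

section \<open>Chevalley--Eilenberg cohomology in degree 3\<close>

definition CE_C2 ::
    "('k::field \<Rightarrow> 'g::ab_group_add \<Rightarrow> 'g) \<Rightarrow> ('k \<Rightarrow> 'm::ab_group_add \<Rightarrow> 'm) \<Rightarrow>
     ('g \<Rightarrow> 'g \<Rightarrow> 'm) set" where
  "CE_C2 scg scm = {\<omega>. bilinear_map scg scg scm \<omega> \<and> (\<forall>x. \<omega> x x = 0)}"

definition CE_C3 ::
    "('k::field \<Rightarrow> 'g::ab_group_add \<Rightarrow> 'g) \<Rightarrow> ('k \<Rightarrow> 'm::ab_group_add \<Rightarrow> 'm) \<Rightarrow>
     ('g \<Rightarrow> 'g \<Rightarrow> 'g \<Rightarrow> 'm) set" where
  "CE_C3 scg scm = {\<phi>. trilinear_map scg scm \<phi> \<and>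
     (\<forall>x y. \<phi> x x y = 0 \<and> \<phi> x y x = 0 \<and> \<phi> x y y = 0)}"

definition CE_d2 ::
    "('g \<Rightarrow> 'g \<Rightarrow> 'g) \<Rightarrow> ('g \<Rightarrow> 'm \<Rightarrow> 'm::ab_group_add) \<Rightarrow>
     ('g \<Rightarrow> 'g \<Rightarrow> 'm) \<Rightarrow> ('g \<Rightarrow> 'g \<Rightarrow> 'g \<Rightarrow> 'm)" where
  "CE_d2 br act \<omega> = (\<lambda>x y z.
     act x (\<omega> y z) - act y (\<omega> x z) + act z (\<omega> x y)
     - \<omega> (br x y) z + \<omega> (br x z) y - \<omega> (br y z) x)"

definition CE_d3 ::
    "('g \<Rightarrow> 'g \<Rightarrow> 'g) \<Rightarrow> ('g \<Rightarrow> 'm \<Rightarrow> 'm::ab_group_add) \<Rightarrow>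
     ('g \<Rightarrow> 'g \<Rightarrow> 'g \<Rightarrow> 'm) \<Rightarrow> ('g \<Rightarrow> 'g \<Rightarrow> 'g \<Rightarrow> 'g \<Rightarrow> 'm)" where
  "CE_d3 br act \<phi> = (\<lambda>x y z w.
     act x (\<phi> y z w) - act y (\<phi> x z w) + act z (\<phi> x y w) - act w (\<phi> x y z)
     - \<phi> (br x y) z w + \<phi> (br x z) y w - \<phi> (br x w) y z
     - \<phi> (br y z) x w + \<phi> (br y w) x z - \<phi> (br z w) x y)"

definition CE_Z3 ::
    "('k::field \<Rightarrow> 'g::ab_group_add \<Rightarrow> 'g) \<Rightarrow> ('g \<Rightarrow> 'g \<Rightarrow> 'g) \<Rightarrow>
     ('k \<Rightarrow> 'm::ab_group_add \<Rightarrow> 'm) \<Rightarrow> ('g \<Rightarrow> 'm \<Rightarrow> 'm) \<Rightarrow> ('g \<Rightarrow> 'g \<Rightarrow> 'g \<Rightarrow> 'm) set" where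
  "CE_Z3 scg br scm act = {\<phi> \<in> CE_C3 scg scm. CE_d3 br act \<phi> = 0}"

definition CE_B3 ::
    "('k::field \<Rightarrow> 'g::ab_group_add \<Rightarrow> 'g) \<Rightarrow> ('g \<Rightarrow> 'g \<Rightarrow> 'g) \<Rightarrow>
     ('k \<Rightarrow> 'm::ab_group_add \<Rightarrow> 'm) \<Rightarrow> ('g \<Rightarrow> 'm \<Rightarrow> 'm) \<Rightarrow> ('g \<Rightarrow> 'g \<Rightarrow> 'g \<Rightarrow> 'm) set" where
  "CE_B3 scg br scm act = CE_d2 br act ` CE_C2 scg scm"

definition CE_H3 ::
    "('k::field \<Rightarrow> 'g::ab_group_add \<Rightarrow> 'g) \<Rightarrow> ('g \<Rightarrow> 'g \<Rightarrow> 'g) \<Rightarrow>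
     ('k \<Rightarrow> 'm::ab_group_add \<Rightarrow> 'm) \<Rightarrow> ('g \<Rightarrow> 'm \<Rightarrow> 'm) \<Rightarrow>
     ('g \<Rightarrow> 'g \<Rightarrow> 'g \<Rightarrow> 'm) set set" where
  "CE_H3 scg br scm act = quot (CE_Z3 scg br scm act) (CE_B3 scg br scm act)"

definition CE_class ::
    "('k::field \<Rightarrow> 'g::ab_group_add \<Rightarrow> 'g) \<Rightarrow> ('g \<Rightarrow> 'g \<Rightarrow> 'g) \<Rightarrow>
     ('k \<Rightarrow> 'm::ab_group_add \<Rightarrow> 'm) \<Rightarrow> ('g \<Rightarrow> 'm \<Rightarrow> 'm) \<Rightarrow>
     ('g \<Rightarrow> 'g \<Rightarrow> 'g \<Rightarrow> 'm) \<Rightarrow> ('g \<Rightarrow> 'g \<Rightarrow> 'g \<Rightarrow> 'm) set" where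
  "CE_class scg br scm act \<phi> = \<phi> +o CE_B3 scg br scm act"

definition CE_scale ::
    "('k::field \<Rightarrow> 'g::ab_group_add \<Rightarrow> 'g) \<Rightarrow> ('g \<Rightarrow> 'g \<Rightarrow> 'g) \<Rightarrow>
     ('k \<Rightarrow> 'm::ab_group_add \<Rightarrow> 'm) \<Rightarrow> ('g \<Rightarrow> 'm \<Rightarrow> 'm) \<Rightarrow> 'k \<Rightarrow>
     ('g \<Rightarrow> 'g \<Rightarrow> 'g \<Rightarrow> 'm) set \<Rightarrow> ('g \<Rightarrow> 'g \<Rightarrow> 'g \<Rightarrow> 'm) set" where
  "CE_scale scg br scm act =
     quot_scale (fun_scale (fun_scale (fun_scale scm))) (CE_B3 scg br scm act)"

section \<open>The abelianization and \<open>Hom(\<and>\<^sup>2 \<aa>, M)\<close>\<close>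

definition derived :: "('k::field \<Rightarrow> 'g::ab_group_add \<Rightarrow> 'g) \<Rightarrow> ('g \<Rightarrow> 'g \<Rightarrow> 'g) \<Rightarrow> 'g set" where
  "derived scg br = module.span scg {br x y | x y. True}"

definition ab :: "('k::field \<Rightarrow> 'g::ab_group_add \<Rightarrow> 'g) \<Rightarrow> ('g \<Rightarrow> 'g \<Rightarrow> 'g) \<Rightarrow> 'g set set" where
  "ab scg br = quot UNIV (derived scg br)"

definition ab_proj :: "('k::field \<Rightarrow> 'g::ab_group_add \<Rightarrow> 'g) \<Rightarrow> ('g \<Rightarrow> 'g \<Rightarrow> 'g) \<Rightarrow> 'g \<Rightarrow> 'g set" where
  "ab_proj scg br x = x +o derived scg br"

definition ab_scale ::
    "('k::field \<Rightarrow> 'g::ab_group_add \<Rightarrow> 'g) \<Rightarrow> ('g \<Rightarrow> 'g \<Rightarrow> 'g) \<Rightarrow> 'k \<Rightarrow> 'g set \<Rightarrow> 'g set" where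
  "ab_scale scg br = quot_scale scg (derived scg br)"

text \<open>
  Linear maps \<open>\<and>\<^sup>2 \<aa> \<rightarrow> M\<close> as alternating bilinear maps on \<open>\<aa>\<close>, set to \<open>0\<close> outside the carrier of
  \<open>\<aa>\<close> so that pointwise addition and equality are those of maps on \<open>\<aa>\<close>.
\<close>

definition linear_wedge2_ab ::
    "('k::field \<Rightarrow> 'g::ab_group_add \<Rightarrow> 'g) \<Rightarrow> ('g \<Rightarrow> 'g \<Rightarrow> 'g) \<Rightarrow>
     ('k \<Rightarrow> 'm::ab_group_add \<Rightarrow> 'm) \<Rightarrow> ('g set \<Rightarrow> 'g set \<Rightarrow> 'm) set" where
  "linear_wedge2_ab scg br scm = {a.
     (\<forall>X\<in>ab scg br. linear_on (ab_scale scg br) scm (ab scg br) UNIV (\<lambda>Y. a X Y)) \<and>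
     (\<forall>Y\<in>ab scg br. linear_on (ab_scale scg br) scm (ab scg br) UNIV (\<lambda>X. a X Y)) \<and>
     (\<forall>X\<in>ab scg br. a X X = 0) \<and>
     (\<forall>X Y. X \<notin> ab scg br \<or> Y \<notin> ab scg br \<longrightarrow> a X Y = 0)}"

text \<open>
  \<open>Hom\<close> is taken in the category of representations of \<open>\<gg>\<close>, where \<open>\<gg>\<close> acts on \<open>\<aa>\<close> by the action
  induced from the adjoint one and on \<open>\<and>\<^sup>2 \<aa>\<close> by derivations.  Mere linearity would not be enough for
  \<open>\<iota>\<close> to be defined, see \<open>wedge2_ab_in_ZL3_iff\<close> below.  (The induced action on \<open>\<aa>\<close> is
  zero, so these are the linear maps into the invariants of \<open>M\<close>; they are all linear maps if
  \<open>\<gg>\<close> acts trivially on \<open>M\<close>.)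
\<close>

definition Hom_wedge2_ab ::
    "('k::field \<Rightarrow> 'g::ab_group_add \<Rightarrow> 'g) \<Rightarrow> ('g \<Rightarrow> 'g \<Rightarrow> 'g) \<Rightarrow>
     ('k \<Rightarrow> 'm::ab_group_add \<Rightarrow> 'm) \<Rightarrow> ('g \<Rightarrow> 'm \<Rightarrow> 'm) \<Rightarrow> ('g set \<Rightarrow> 'g set \<Rightarrow> 'm) set" where
  "Hom_wedge2_ab scg br scm act = {a \<in> linear_wedge2_ab scg br scm.
     \<forall>z x y. act z (a (ab_proj scg br x) (ab_proj scg br y)) =
       a (ab_proj scg br (br z x)) (ab_proj scg br y) + a (ab_proj scg br x) (ab_proj scg br (br z y))}"

definition ab_pullback ::
    "('k::field \<Rightarrow> 'g::ab_group_add \<Rightarrow> 'g) \<Rightarrow> ('g \<Rightarrow> 'g \<Rightarrow> 'g) \<Rightarrow>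
     ('g set \<Rightarrow> 'g set \<Rightarrow> 'm) \<Rightarrow> ('g \<Rightarrow> 'g \<Rightarrow> 'm)" where
  "ab_pullback scg br a = (\<lambda>x y. a (ab_proj scg br x) (ab_proj scg br y))"

lemma (in vector_space) coset_add:
  assumes "subspace U"
  shows "(x + y) +o U = (x +o U) + (y +o U)"
proof (intro set_eqI iffI)
  fix v assume "v \<in> (x + y) +o U"
  then obtain u where u: "u \<in> U" "v = x + y + u" by (auto simp: elt_set_plus_def)
  then have "v = (x + u) + (y + 0)" by simp
  with u(1) show "v \<in> (x +o U) + (y +o U)"
    using subspace_0[OF assms] unfolding elt_set_plus_def set_plus_def by blast
next
  fix v assume "v \<in> (x +o U) + (y +o U)"
  then obtain u u' where u: "u \<in> U" "u' \<in> U" "v = (x + u) + (y + u')"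
    by (auto simp: elt_set_plus_def set_plus_def)
  then have "v = x + y + (u + u')" by (simp add: algebra_simps)
  with u show "v \<in> (x + y) +o U"
    using subspace_add[OF assms] unfolding elt_set_plus_def by blast
qed

lemma (in vector_space) coset_scale:
  assumes "subspace U"
  shows "scale c x +o U = quot_scale scale U c (x +o U)"
proof (intro set_eqI iffI)
  fix v assume "v \<in> scale c x +o U"
  then obtain u where u: "u \<in> U" "v = scale c x + u" by (auto simp: elt_set_plus_def)
  moreover have "x \<in> x +o U"
    using subspace_0[OF assms] by (force simp: elt_set_plus_def)
  ultimately show "v \<in> quot_scale scale U c (x +o U)"
    unfolding quot_scale_def set_plus_def by blast
next
  fix v assume "v \<in> quot_scale scale U c (x +o U)"
  then obtain u u' where u: "u \<in> U" "u' \<in> U" "v = scale c (x + u) + u'"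
    by (auto simp: elt_set_plus_def set_plus_def quot_scale_def)
  then have "v = scale c x + (scale c u + u')" by (simp add: scale_right_distrib add.assoc)
  with u show "v \<in> scale c x +o U"
    using subspace_add[OF assms] subspace_scale[OF assms] unfolding elt_set_plus_def by blast
qed

lemma linear_map_0: "Vector_Spaces.linear s1 s2 f \<Longrightarrow> f 0 = 0"
  unfolding Vector_Spaces.linear_iff by (metis add_cancel_right_right add_0)

context lie_representation
begin

lemma subspace_derived: "subspace (derived scg br)"
  unfolding derived_def by (rule subspace_span)

lemma ab_proj_in_ab: "ab_proj scg br x \<in> ab scg br"
  by (simp add: ab_proj_def ab_def quot_def)

lemma ab_proj_add: "ab_proj scg br (x + y) = ab_proj scg br x + ab_proj scg br y"
  unfolding ab_proj_def by (rule coset_add[OF subspace_derived])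

lemma ab_proj_scale: "ab_proj scg br (scg c x) = ab_scale scg br c (ab_proj scg br x)"
  unfolding ab_proj_def ab_scale_def by (rule coset_scale[OF subspace_derived])

lemma ab_proj_br: "ab_proj scg br (br x y) = ab_proj scg br 0"
proof -
  have d: "br x y \<in> derived scg br"
    unfolding derived_def by (rule span_base) blast
  have "br x y + u \<in> derived scg br" if "u \<in> derived scg br" for u
    using subspace_add[OF subspace_derived d that] .
  moreover have "\<exists>b\<in>derived scg br. u = br x y + b" if "u \<in> derived scg br" for u
    by (rule bexI[of _ "u - br x y"]) (use subspace_diff[OF subspace_derived that d] in auto)
  ultimately show ?thesis
    unfolding ab_proj_def elt_set_plus_def by auto
qed

lemma ab_pullback_linear:
  assumes "a \<in> linear_wedge2_ab scg br scm"
  shows "bilinear_map scg scg scm (ab_pullback scg br a)"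
  using assms
  by (auto simp: bilinear_map_def Vector_Spaces.linear_iff vector_space_axioms M.vector_space_axioms
      ab_pullback_def linear_wedge2_ab_def linear_on_def ab_proj_in_ab ab_proj_add ab_proj_scale)

lemma ab_pullback_br:
  assumes "a \<in> linear_wedge2_ab scg br scm"
  shows "ab_pullback scg br a (br x y) z = 0" "ab_pullback scg br a z (br x y) = 0"
proof -
  note lin = ab_pullback_linear[OF assms, unfolded bilinear_map_def]
  have "ab_pullback scg br a 0 z = 0"
    using linear_map_0 lin by blast
  moreover have "ab_pullback scg br a z 0 = 0"
    using linear_map_0 lin by blast
  ultimately show "ab_pullback scg br a (br x y) z = 0" "ab_pullback scg br a z (br x y) = 0"
    by (simp_all add: ab_pullback_def ab_proj_br)
qed

theorem wedge2_ab_in_ZL3_iff: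
  assumes "a \<in> linear_wedge2_ab scg br scm"
  shows "(ab_pullback scg br a, 0) \<in> ZL3 scg br scm act \<longleftrightarrow> a \<in> Hom_wedge2_ab scg br scm act"
proof -
  have "act x 0 = 0" for x
    using act_bilinear linear_map_0 unfolding bilinear_map_def by blast
  moreover have "trilinear_map scg scm (0 :: 'g \<Rightarrow> 'g \<Rightarrow> 'g \<Rightarrow> 'm)"
    by (simp add: trilinear_map_def Vector_Spaces.linear_iff vector_space_axioms
        M.vector_space_axioms)
  ultimately have "(ab_pullback scg br a, 0) \<in> ZL3 scg br scm act \<longleftrightarrow>
      (\<forall>x y z. act z (ab_pullback scg br a x y) = 0)"
    using ab_pullback_linear[OF assms] ab_pullback_br[OF assms] by (auto simp: ZL3_def)
  also have "\<dots> \<longleftrightarrow> a \<in> Hom_wedge2_ab scg br scm act"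
    using assms ab_pullback_br[OF assms] by (auto simp: Hom_wedge2_ab_def ab_pullback_def)
  finally show ?thesis .
qed

lemma Hom_wedge2_ab_trivial_action:
  assumes "\<And>x m. act x m = 0"
  shows "Hom_wedge2_ab scg br scm act = linear_wedge2_ab scg br scm"
proof -
  have "a \<in> Hom_wedge2_ab scg br scm act" if a: "a \<in> linear_wedge2_ab scg br scm" for a
    using a assms ab_pullback_br[OF a] by (simp add: Hom_wedge2_ab_def ab_pullback_def)
  then show ?thesis
    by (auto simp: Hom_wedge2_ab_def)
qed

end

section \<open>The maps of the sequence\<close>

definition alt_sum3 ::
    "('k::field \<Rightarrow> 'm::ab_group_add \<Rightarrow> 'm) \<Rightarrow> ('g \<Rightarrow> 'g \<Rightarrow> 'g \<Rightarrow> 'm) \<Rightarrow> ('g \<Rightarrow> 'g \<Rightarrow> 'g \<Rightarrow> 'm)" where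
  "alt_sum3 scm t = (\<lambda>x1 x2 x3. let x = (\<lambda>i::nat. [x1, x2, x3] ! i) in
     \<Sum>\<sigma> | \<sigma> permutes {0, 1, 2}. scm (of_int (sign \<sigma>)) (t (x (\<sigma> 0)) (x (\<sigma> 1)) (x (\<sigma> 2))))"

definition jbar ::
    "('g \<Rightarrow> 'g \<Rightarrow> 'g) \<Rightarrow> ('k::field \<Rightarrow> 'm::ab_group_add \<Rightarrow> 'm) \<Rightarrow>
     ('g \<Rightarrow> 'g \<Rightarrow> 'm) \<Rightarrow> ('g \<Rightarrow> 'g \<Rightarrow> 'g \<Rightarrow> 'm) \<Rightarrow> ('g \<Rightarrow> 'g \<Rightarrow> 'g \<Rightarrow> 'm)" where
  "jbar br scm s j = (\<lambda>x1 x2 x3.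
     scm (1 / 6) (alt_sum3 scm j x1 x2 x3) -
     scm (1 / 12) (alt_sum3 scm (\<lambda>y1 y2 y3. s (br y1 y2) y3) x1 x2 x3))"

definition ss ::
    "('k::field \<Rightarrow> 'g::ab_group_add \<Rightarrow> 'g) \<Rightarrow> ('g \<Rightarrow> 'g \<Rightarrow> 'g) \<Rightarrow>
     ('k \<Rightarrow> 'm::ab_group_add \<Rightarrow> 'm) \<Rightarrow> ('g \<Rightarrow> 'm \<Rightarrow> 'm) \<Rightarrow>
     (('g \<Rightarrow> 'g \<Rightarrow> 'm) \<times> ('g \<Rightarrow> 'g \<Rightarrow> 'g \<Rightarrow> 'm)) set \<Rightarrow> ('g \<Rightarrow> 'g \<Rightarrow> 'g \<Rightarrow> 'm) set" where
  "ss scg br scm act = induced (\<lambda>(s, j). CE_class scg br scm act (jbar br scm s j))"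

definition iota ::
    "('k::field \<Rightarrow> 'g::ab_group_add \<Rightarrow> 'g) \<Rightarrow> ('g \<Rightarrow> 'g \<Rightarrow> 'g) \<Rightarrow>
     ('k \<Rightarrow> 'm::ab_group_add \<Rightarrow> 'm) \<Rightarrow> ('g \<Rightarrow> 'm \<Rightarrow> 'm) \<Rightarrow>
     ('g set \<Rightarrow> 'g set \<Rightarrow> 'm) \<Rightarrow> (('g \<Rightarrow> 'g \<Rightarrow> 'm) \<times> ('g \<Rightarrow> 'g \<Rightarrow> 'g \<Rightarrow> 'm)) set" where
  "iota scg br scm act a = HL3_class scg br scm act (ab_pullback scg br a, 0)"

definition splitting ::
    "('k::field \<Rightarrow> 'g::ab_group_add \<Rightarrow> 'g) \<Rightarrow> ('g \<Rightarrow> 'g \<Rightarrow> 'g) \<Rightarrow>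
     ('k \<Rightarrow> 'm::ab_group_add \<Rightarrow> 'm) \<Rightarrow> ('g \<Rightarrow> 'm \<Rightarrow> 'm) \<Rightarrow>
     ('g \<Rightarrow> 'g \<Rightarrow> 'g \<Rightarrow> 'm) set \<Rightarrow> (('g \<Rightarrow> 'g \<Rightarrow> 'm) \<times> ('g \<Rightarrow> 'g \<Rightarrow> 'g \<Rightarrow> 'm)) set" where
  "splitting scg br scm act = induced (\<lambda>\<phi>. HL3_class scg br scm act (0, \<phi>))"

end

theory Submission
  imports Defs
begin

text \<open>
  Write \<open>\<delta> f = (f + f\<^sup>T, d f)\<close> for the coboundary of a bilinear map \<open>f\<close>; it is a cocycle because a Lie
  algebra is a left Leibniz algebra.  If \<open>f\<close> is alternating, then \<open>\<delta> f = (0, d f)\<close> is a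
  Chevalley--Eilenberg coboundary; if \<open>f\<close> is symmetric, then the skew-symmetrization of \<open>\<delta> f\<close> is \<open>0\<close>,
  the term with coefficient \<open>1/12\<close> cancelling the alternating sum of \<open>d f\<close>.  For a cocycle \<open>(s, j)\<close>
  take \<open>f = (s + s\<^sup>T)/4\<close>.  Then \<open>(s, j) - \<delta> f\<close> has the skew first component \<open>s' = (s - s\<^sup>T)/2\<close>, and
  the cocycle conditions force \<open>s'\<close> to vanish on brackets and to take invariant values, so that it
  comes from \<open>Hom(\<and>\<^sup>2 \<aa>, M)\<close>, while its second component is alternating and hence equal to its own
  skew-symmetrization.  So \<open>(s, j) = \<delta> f + (s', 0) + (0, \<phi>)\<close>, where \<open>\<phi>\<close> is the skew-symmetrization
  of \<open>(s, j)\<close>, and exactness and the splitting follow.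
\<close>

section \<open>Maps induced on quotient spaces\<close>

lemma vector_space_fun_scale:
  assumes "vector_space s"
  shows "vector_space (fun_scale s)"
proof -
  interpret vector_space s by fact
  show ?thesis
    by unfold_locales
      (auto simp: fun_scale_def fun_eq_iff scale_right_distrib scale_left_distrib)
qed

lemma vector_space_prod_scale:
  assumes "vector_space s" and "vector_space t"
  shows "vector_space (prod_scale s t)"
proof -
  interpret S: vector_space s by fact
  interpret T: vector_space t by fact
  show ?thesis
    by unfold_locales
      (auto simp: prod_scale_def S.scale_right_distrib S.scale_left_distrib
        T.scale_right_distrib T.scale_left_distrib)
qed

lemma (in vector_space) coset_eq_iff:
  assumes "subspace U"
  shows "x +o U = y +o U \<longleftrightarrow> x - y \<in> U"
proof
  assume "x +o U = y +o U"
  moreover have "x \<in> x +o U"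
    using subspace_0[OF assms] by (force simp: elt_set_plus_def)
  ultimately obtain u where "u \<in> U" "x = y + u"
    by (auto simp: elt_set_plus_def)
  then show "x - y \<in> U" by simp
next
  assume d: "x - y \<in> U"
  have "x +o U \<subseteq> y +o U" if "x - y \<in> U" for x y
  proof
    fix v assume "v \<in> x +o U"
    then obtain u where u: "u \<in> U" "v = x + u" by (auto simp: elt_set_plus_def)
    then have "v = y + ((x - y) + u)" by simp
    then show "v \<in> y +o U"
      using subspace_add[OF assms that u(1)] unfolding elt_set_plus_def by blast
  qed
  moreover have "y - x \<in> U"
    using subspace_neg[OF assms d] by simp
  ultimately show "x +o U = y +o U"
    using d by blast
qed

lemma (in vector_space) coset_eq_self_iff:
  assumes "subspace U"
  shows "x +o U = U \<longleftrightarrow> x \<in> U"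
  using coset_eq_iff[OF assms, of x 0] by (simp add: set_zero_plus)

text \<open>Collects what makes a linear map \<open>F\<close> on representatives descend to cosets.
  It serves twice: for skew-symmetrization and, in the opposite direction, for
  \<open>Pair 0\<close>.\<close>

locale quotient_map = V: vector_space sV + W: vector_space sW
  for sV :: "'k::field \<Rightarrow> 'v::ab_group_add \<Rightarrow> 'v" and sW :: "'k \<Rightarrow> 'w::ab_group_add \<Rightarrow> 'w" +
  fixes Z U Z' U' and F
  assumes Z: "V.subspace Z" and U: "V.subspace U" "U \<subseteq> Z"
    and U': "W.subspace U'"
    and lin: "linear_on sV sW Z Z' F"
    and F_U: "\<And>u. u \<in> U \<Longrightarrow> F u \<in> U'"
begin

lemma induced_coset:
  assumes "v \<in> Z"
  shows "induced (\<lambda>v. F v +o U') (v +o U) = F v +o U'"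
proof -
  have "F (v + u) +o U' = F v +o U'" if "u \<in> U" for u
  proof -
    have "F (v + u) = F v + F u"
      using lin assms that U(2) by (auto simp: linear_on_def)
    then show ?thesis
      using F_U[OF that] by (simp add: W.coset_eq_iff[OF U'])
  qed
  \<comment> \<open>The coset must be nonempty for its image to be a singleton, as
    \<open>the_elem\<close> requires.\<close>
  moreover have "U \<noteq> {}"
    using V.subspace_0[OF U(1)] by blast
  ultimately have "(\<lambda>v. F v +o U') ` (v +o U) = {F v +o U'}"
    unfolding elt_set_plus_def[of v U] by (auto simp: image_iff)
  then show ?thesis
    by (simp add: induced_def)
qed

lemma linear_on_induced:
  "linear_on (quot_scale sV U) (quot_scale sW U') (quot Z U) (quot Z' U')
    (induced (\<lambda>v. F v +o U'))"
  unfolding linear_on_def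
proof (intro conjI ballI allI)
  fix X assume "X \<in> quot Z U"
  then obtain x where x: "x \<in> Z" "X = x +o U" by (auto simp: quot_def)
  have "F x \<in> Z'"
    using lin x by (simp add: linear_on_def)
  then show "induced (\<lambda>v. F v +o U') X \<in> quot Z' U'"
    using x by (auto simp: induced_coset quot_def)
  show "induced (\<lambda>v. F v +o U') (quot_scale sV U c X) =
      quot_scale sW U' c (induced (\<lambda>v. F v +o U') X)" for c
    using lin x V.subspace_scale[OF Z]
    by (simp add: linear_on_def induced_coset
        flip: V.coset_scale[OF U(1)] W.coset_scale[OF U'])
  fix Y assume "Y \<in> quot Z U"
  then obtain y where y: "y \<in> Z" "Y = y +o U" by (auto simp: quot_def)
  show "induced (\<lambda>v. F v +o U') (X + Y) =
      induced (\<lambda>v. F v +o U') X + induced (\<lambda>v. F v +o U') Y"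
    using lin x y V.subspace_add[OF Z]
    by (simp add: linear_on_def induced_coset
        flip: V.coset_add[OF U(1)] W.coset_add[OF U'])
qed

end

section \<open>Skew-symmetrization\<close>

text \<open>Each permutation of \<open>{0, 1, 2}\<close> is a possibly trivial transposition of 0
  with some point composed with a permutation of \<open>{1, 2}\<close>, and likewise one level down;
  this yields the six terms with their signs.\<close>

lemma alt_sum3_expand:
  assumes "vector_space scm"
  shows "alt_sum3 scm t x y z =
    t x y z + t y z x + t z x y - t y x z - t x z y - t z y x"
proof -
  interpret vector_space scm by fact
  have f: "finite {1, 2::nat}" "(0::nat) \<notin> {1, 2}" "finite {2::nat}" "(1::nat) \<notin> {2}"
    by auto
  show ?thesis
    unfolding alt_sum3_def Let_def sum_over_permutations_insert[OF f(1,2)]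
      sum_over_permutations_insert[OF f(3,4)] permutes_sing
    by (simp add: sign_compose permutation_compose permutation_swap_id sign_swap_id sign_id
        transpose_def numeral_2_eq_2 algebra_simps)
qed

section \<open>Additivity rules for multilinear maps, the action and the bracket\<close>

lemma additive_0_neg_diff:
  fixes h :: "'x::ab_group_add \<Rightarrow> 'y::ab_group_add"
  assumes "\<And>x y. h (x + y) = h x + h y"
  shows "h 0 = 0" "h (- x) = - h x" "h (x - y) = h x - h y"
proof -
  show 0: "h 0 = 0"
    using assms[of 0 0] by simp
  show n: "h (- x) = - h x" for x
    using assms[of x "- x"] 0 by (simp add: eq_neg_iff_add_eq_0 add.commute)
  show "h (x - y) = h x - h y"
    using assms[of x "- y"] n by simp
qed

context lie_representation
begin

lemma bilinear_iff:
  "bilinear_map scg scg scm f \<longleftrightarrow>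
    (\<forall>x y z. f (x + y) z = f x z + f y z) \<and> (\<forall>x y z. f x (y + z) = f x y + f x z) \<and>
    (\<forall>c x y. f (scg c x) y = scm c (f x y)) \<and> (\<forall>c x y. f x (scg c y) = scm c (f x y))"
  by (auto simp: bilinear_map_def Vector_Spaces.linear_iff vector_space_axioms
      M.vector_space_axioms)

lemma trilinear_iff:
  "trilinear_map scg scm j \<longleftrightarrow>
    (\<forall>x x' y z. j (x + x') y z = j x y z + j x' y z) \<and>
    (\<forall>x y y' z. j x (y + y') z = j x y z + j x y' z) \<and>
    (\<forall>x y z z'. j x y (z + z') = j x y z + j x y z') \<and>
    (\<forall>c x y z. j (scg c x) y z = scm c (j x y z)) \<and>
    (\<forall>c x y z. j x (scg c y) z = scm c (j x y z)) \<and>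
    (\<forall>c x y z. j x y (scg c z) = scm c (j x y z))"
  by (auto simp: trilinear_map_def Vector_Spaces.linear_iff vector_space_axioms
      M.vector_space_axioms)

lemma bilinear_simps:
  assumes "bilinear_map scg scg scm f"
  shows "f (x + y) z = f x z + f y z" "f x (y + z) = f x y + f x z"
    "f (scg c x) y = scm c (f x y)" "f x (scg c y) = scm c (f x y)"
    "f 0 y = 0" "f x 0 = 0" "f (- x) y = - f x y" "f x (- y) = - f x y"
    "f (x - y) z = f x z - f y z" "f x (y - z) = f x y - f x z"
proof -
  have l: "f (x + y) z = f x z + f y z" and r: "f x (y + z) = f x y + f x z" for x y z
    using assms by (auto simp: bilinear_iff)
  show "f (x + y) z = f x z + f y z" "f x (y + z) = f x y + f x z"
    "f (scg c x) y = scm c (f x y)" "f x (scg c y) = scm c (f x y)"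
    using assms by (auto simp: bilinear_iff)
  show "f 0 y = 0" "f (- x) y = - f x y" "f (x - y) z = f x z - f y z"
    using additive_0_neg_diff[of "\<lambda>x. f x y" for y] l by blast+
  show "f x 0 = 0" "f x (- y) = - f x y" "f x (y - z) = f x y - f x z"
    using additive_0_neg_diff[of "f x" for x] r by blast+
qed

lemma act_simps:
  "act (x + y) m = act x m + act y m" "act x (m + n) = act x m + act x n"
  "act (scg c x) m = scm c (act x m)" "act x (scm c m) = scm c (act x m)"
  "act x 0 = 0" "act (- x) m = - act x m" "act x (- m) = - act x m"
  "act (x - y) m = act x m - act y m" "act x (m - n) = act x m - act x n"
proof -
  have l: "act (x + y) m = act x m + act y m" and r: "act x (m + n) = act x m + act x n"
    for x y m n
    using act_bilinear by (auto simp: bilinear_map_def Vector_Spaces.linear_iff)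
  show "act (x + y) m = act x m + act y m" "act x (m + n) = act x m + act x n"
    "act (scg c x) m = scm c (act x m)" "act x (scm c m) = scm c (act x m)"
    using act_bilinear by (auto simp: bilinear_map_def Vector_Spaces.linear_iff)
  show "act (- x) m = - act x m" "act (x - y) m = act x m - act y m"
    using additive_0_neg_diff[of "\<lambda>x. act x m" for m] l by blast+
  show "act x 0 = 0" "act x (- m) = - act x m" "act x (m - n) = act x m - act x n"
    using additive_0_neg_diff[of "act x" for x] r by blast+
qed

lemma br_simps:
  "br (x + y) z = br x z + br y z" "br x (y + z) = br x y + br x z"
  "br (scg c x) y = scg c (br x y)" "br x (scg c y) = scg c (br x y)"
  "br (- x) y = - br x y" "br x (- y) = - br x y"
proof -
  have l: "br (x + y) z = br x z + br y z" and r: "br x (y + z) = br x y + br x z" for x y z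
    using br_bilinear by (auto simp: bilinear_map_def Vector_Spaces.linear_iff)
  show "br (x + y) z = br x z + br y z" "br x (y + z) = br x y + br x z"
    "br (scg c x) y = scg c (br x y)" "br x (scg c y) = scg c (br x y)"
    using br_bilinear by (auto simp: bilinear_map_def Vector_Spaces.linear_iff)
  show "br (- x) y = - br x y"
    using additive_0_neg_diff[of "\<lambda>x. br x y" for y] l by blast+
  show "br x (- y) = - br x y"
    using additive_0_neg_diff[of "br x" for x] r by blast+
qed

lemma br_anti: "br y x = - br x y"
proof -
  have "br x y + br y x = 0"
    using br_self[of "x + y"] by (simp only: br_simps) (simp add: br_self add.commute)
  then show ?thesis
    by (metis add.commute eq_neg_iff_add_eq_0)
qed

text \<open>The Jacobi identity in left Leibniz form. As a rewrite rule alongside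
  \<open>act_br\<close> it nests all brackets to the right, which is how the square of the Leibniz
  differential is seen to vanish.\<close>

lemma br_br: "br (br x y) z = br x (br y z) - br y (br x z)"
  using jacobi[of x y z] br_anti[of z "br x y"] br_anti[of z x]
  by (simp add: br_simps algebra_simps eq_neg_iff_add_eq_0)

section \<open>Leibniz cochains, cocycles and coboundaries\<close>

abbreviation "Z \<equiv> ZL3 scg br scm act"
abbreviation "B \<equiv> BL3 scg br scm act"
abbreviation "scale2 \<equiv> fun_scale (fun_scale scm)"
abbreviation "scale3 \<equiv> fun_scale (fun_scale (fun_scale scm))"

sublocale C2: vector_space scale2
  by (intro vector_space_fun_scale M.vector_space_axioms)

sublocale C3: vector_space scale3
  by (intro vector_space_fun_scale M.vector_space_axioms)

sublocale L: vector_space "prod_scale scale2 scale3"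
  by (intro vector_space_prod_scale C2.vector_space_axioms C3.vector_space_axioms)

text \<open>The Leibniz differential on 2-cochains; the right action is minus the left one, hence
  the sign of the third term.\<close>

definition leib_d2 :: "('g \<Rightarrow> 'g \<Rightarrow> 'm) \<Rightarrow> 'g \<Rightarrow> 'g \<Rightarrow> 'g \<Rightarrow> 'm" where
  "leib_d2 f = (\<lambda>x y z. act x (f y z) - act y (f x z) + act z (f x y)
     - f (br x y) z - f y (br x z) + f x (br y z))"

definition cobound ::
    "('g \<Rightarrow> 'g \<Rightarrow> 'm) \<Rightarrow> ('g \<Rightarrow> 'g \<Rightarrow> 'm) \<times> ('g \<Rightarrow> 'g \<Rightarrow> 'g \<Rightarrow> 'm)" where
  "cobound f = ((\<lambda>x y. f x y + f y x), leib_d2 f)"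

lemma leib_d2_trilinear:
  assumes "bilinear_map scg scg scm f"
  shows "trilinear_map scg scm (leib_d2 f)"
  by (simp add: trilinear_iff leib_d2_def act_simps br_simps bilinear_simps[OF assms]
      M.scale_right_distrib M.scale_right_diff_distrib algebra_simps)

lemma cobound_in_ZL3:
  assumes "bilinear_map scg scg scm f"
  shows "cobound f \<in> Z"
proof -
  note f = bilinear_simps[OF assms]
  have "bilinear_map scg scg scm (\<lambda>x y. f x y + f y x)"
    by (simp add: bilinear_iff f M.scale_right_distrib algebra_simps)
  \<comment> \<open>All terms but those with \<open>act z\<close> cancel; for
    \<open>f (br x y) z\<close> this uses that the bracket is skew.\<close>
  moreover have "leib_d2 f x y z + leib_d2 f y x z = act z (f x y + f y x)" for x y z
    using br_anti[of y x] by (simp add: leib_d2_def act_simps f)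
  moreover have "leib_d2 f x y z + leib_d2 f x z y = act x (f y z + f z y)
      - (f (br x y) z + f z (br x y)) - (f y (br x z) + f (br x z) y)" for x y z
    using br_anti[of z y] by (simp add: leib_d2_def act_simps f)
  \<comment> \<open>The square of the differential: expanding the action and the bracket of
    \<open>br x y\<close> as commutators makes everything cancel.\<close>
  moreover have "act x (leib_d2 f y z w) - act y (leib_d2 f x z w) + act z (leib_d2 f x y w)
      + (- act w (leib_d2 f x y z))
      - leib_d2 f (br x y) z w - leib_d2 f y (br x z) w - leib_d2 f y z (br x w)
      + leib_d2 f x (br y z) w + leib_d2 f x z (br y w) - leib_d2 f x y (br z w) = 0" for x y z w
    by (simp add: leib_d2_def act_simps f act_br br_br)
  ultimately show ?thesis
    using leib_d2_trilinear[OF assms] by (simp add: ZL3_def cobound_def add.commute)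
qed

text \<open>Coboundaries being cocycles, \<open>B\<close> is the image of a vector space under the
  linear map \<open>cobound\<close>; its subspace property rests on this form.\<close>

lemma BL3_eq: "B = cobound ` {f. bilinear_map scg scg scm f}"
proof -
  have "(s, j) \<in> B \<longleftrightarrow> (s, j) \<in> Z \<and> (s, j) \<in> cobound ` {f. bilinear_map scg scg scm f}" for s j
    by (auto simp: BL3_def cobound_def leib_d2_def fun_eq_iff image_iff)
  then have "B = Z \<inter> cobound ` {f. bilinear_map scg scg scm f}"
    by (intro set_eqI) (simp add: split_paired_all)
  also have "\<dots> = cobound ` {f. bilinear_map scg scg scm f}"
    using cobound_in_ZL3 by (intro Int_absorb1 image_subsetI) simp
  finally show ?thesis .
qed

lemma subspace_bilinear: "C2.subspace {f. bilinear_map scg scg scm f}"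
  by (rule C2.subspaceI)
    (auto simp: bilinear_iff fun_scale_def M.scale_right_distrib algebra_simps)

lemma subspace_trilinear: "C3.subspace {j. trilinear_map scg scm j}"
  by (rule C3.subspaceI)
    (auto simp: trilinear_iff fun_scale_def M.scale_right_distrib algebra_simps)

lemma cobound_add: "cobound (f + g) = cobound f + cobound g"
  by (simp add: cobound_def leib_d2_def fun_eq_iff act_simps algebra_simps)

lemma cobound_scale: "cobound (scale2 c f) = prod_scale scale2 scale3 c (cobound f)"
  by (simp add: cobound_def leib_d2_def prod_scale_def fun_scale_def fun_eq_iff act_simps
      M.scale_right_distrib M.scale_right_diff_distrib)

lemma subspace_BL3: "L.subspace B"
proof (rule L.subspaceI)
  have "cobound 0 = 0"
    by (simp add: cobound_def leib_d2_def zero_prod_def fun_eq_iff act_simps)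
  then show "0 \<in> B"
    using C2.subspace_0[OF subspace_bilinear] by (force simp: BL3_eq)
  show "p + q \<in> B" if "p \<in> B" "q \<in> B" for p q
    using that C2.subspace_add[OF subspace_bilinear]
    by (auto simp: BL3_eq simp flip: cobound_add)
  show "prod_scale scale2 scale3 c p \<in> B" if "p \<in> B" for c p
    using that C2.subspace_scale[OF subspace_bilinear]
    by (auto simp: BL3_eq simp flip: cobound_scale)
qed

text \<open>The Leibniz differential on 3-cochains: the long cocycle condition becomes
  \<open>leib_d3 j = 0\<close>, and is preserved by linear operations because \<open>leib_d3\<close>
  is linear.\<close>

definition leib_d3 :: "('g \<Rightarrow> 'g \<Rightarrow> 'g \<Rightarrow> 'm) \<Rightarrow> 'g \<Rightarrow> 'g \<Rightarrow> 'g \<Rightarrow> 'g \<Rightarrow> 'm" where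
  "leib_d3 j = (\<lambda>x y z w.
     act x (j y z w) - act y (j x z w) + act z (j x y w) - act w (j x y z)
     - j (br x y) z w - j y (br x z) w - j y z (br x w)
     + j x (br y z) w + j x z (br y w) - j x y (br z w))"

lemma ZL3_iff:
  "(s, j) \<in> Z \<longleftrightarrow> bilinear_map scg scg scm s \<and> trilinear_map scg scm j \<and> leib_d3 j = 0 \<and>
     (\<forall>x y z. j x y z + j y x z = act z (s x y)) \<and>
     (\<forall>x y z. j x y z + j x z y = act x (s y z) - s (br x y) z - s y (br x z)) \<and>
     (\<forall>x y z. s (br x y) z = s z (br x y))"
  by (simp add: ZL3_def leib_d3_def fun_eq_iff)

lemma leib_d3_add: "leib_d3 (j + k) = leib_d3 j + leib_d3 k"
  by (simp add: leib_d3_def fun_eq_iff act_simps)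

lemma leib_d3_scale: "leib_d3 (scale3 c j) = fun_scale scale3 c (leib_d3 j)"
  by (simp add: leib_d3_def fun_scale_def fun_eq_iff act_simps
      M.scale_right_distrib M.scale_right_diff_distrib)

lemma subspace_ZL3: "L.subspace Z"
proof (rule L.subspaceI)
  show "0 \<in> Z"
    using C2.subspace_0[OF subspace_bilinear] C3.subspace_0[OF subspace_trilinear]
    by (simp add: zero_prod_def ZL3_iff leib_d3_def act_simps fun_eq_iff)
  show "p + q \<in> Z" if "p \<in> Z" "q \<in> Z" for p q
  proof (cases p; cases q)
    fix s j t k assume p: "p = (s, j)" and q: "q = (t, k)"
    have "j x y z + k x y z + (j y x z + k y x z) = act z (s x y + t x y)"
      "j x y z + k x y z + (j x z y + k x z y) = act x (s y z + t y z)
        - (s (br x y) z + t (br x y) z) - (s y (br x z) + t y (br x z))" for x y z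
    proof -
      have "j x y z + j y x z = act z (s x y)" "k x y z + k y x z = act z (t x y)"
        "j x y z + j x z y = act x (s y z) - s (br x y) z - s y (br x z)"
        "k x y z + k x z y = act x (t y z) - t (br x y) z - t y (br x z)"
        using that unfolding p q ZL3_iff by blast+
      then show "j x y z + k x y z + (j y x z + k y x z) = act z (s x y + t x y)"
        "j x y z + k x y z + (j x z y + k x z y) = act x (s y z + t y z)
          - (s (br x y) z + t (br x y) z) - (s y (br x z) + t y (br x z))"
        unfolding act_simps by (metis add.commute add.left_commute, simp add: algebra_simps)
    qed
    moreover have "s (br x y) z + t (br x y) z = s z (br x y) + t z (br x y)" for x y z
      using that unfolding p q ZL3_iff by metis
    ultimately show ?thesis
      using that C2.subspace_add[OF subspace_bilinear, of s t]
        C3.subspace_add[OF subspace_trilinear, of j k]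
      unfolding p q add_Pair ZL3_iff leib_d3_add plus_fun_apply by (simp add: zero_fun_def)
  qed
  show "prod_scale scale2 scale3 c p \<in> Z" if "p \<in> Z" for c p
  proof (cases p)
    case (Pair s j)
    then show ?thesis
      using that C2.subspace_scale[OF subspace_bilinear, of s c]
        C3.subspace_scale[OF subspace_trilinear, of j c]
      by (simp add: ZL3_iff leib_d3_scale prod_scale_def)
        (simp add: fun_scale_def act_simps fun_eq_iff
          flip: M.scale_right_distrib M.scale_right_diff_distrib)
  qed
qed

lemma BL3_subset_ZL3: "B \<subseteq> Z"
  by (auto simp: BL3_def)

section \<open>Chevalley-Eilenberg cochains among the Leibniz cochains\<close>

abbreviation "Z3 \<equiv> CE_Z3 scg br scm act"
abbreviation "B3 \<equiv> CE_B3 scg br scm act"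
abbreviation "C2 \<equiv> CE_C2 scg scm"

lemma bilinear_alternating_skew:
  assumes "bilinear_map scg scg scm f" and "\<And>x. f x x = 0"
  shows "f y x = - f x y"
proof -
  have "f x y + f y x = 0"
    using assms(2)[of "x + y"] by (simp only: bilinear_simps[OF assms(1)]) (simp add: assms(2) add.commute)
  then show ?thesis
    by (metis add.commute eq_neg_iff_add_eq_0)
qed

lemma CE_C3_skew:
  assumes "\<phi> \<in> CE_C3 scg scm"
  shows "\<phi> y x z = - \<phi> x y z" "\<phi> x z y = - \<phi> x y z"
proof -
  have t: "trilinear_map scg scm \<phi>" and a: "\<phi> u u v = 0" "\<phi> u v v = 0" for u v
    using assms by (auto simp: CE_C3_def)
  have "bilinear_map scg scg scm (\<lambda>x y. \<phi> x y z)" "bilinear_map scg scg scm (\<phi> x)"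
    using t by (auto simp: trilinear_iff bilinear_iff)
  then show "\<phi> y x z = - \<phi> x y z" "\<phi> x z y = - \<phi> x y z"
    using bilinear_alternating_skew a by blast+
qed

text \<open>Moving each bracket into the first slot of an alternating map turns the Leibniz
  differential into the Chevalley-Eilenberg one; with first component 0 the symmetry conditions on
  \<open>\<phi>\<close> just say that it is skew.\<close>

lemma zero_pair_in_ZL3_iff:
  assumes "\<phi> \<in> CE_C3 scg scm"
  shows "(0, \<phi>) \<in> Z \<longleftrightarrow> \<phi> \<in> Z3"
proof -
  note s = CE_C3_skew[OF assms]
  have "leib_d3 \<phi> x y z w = CE_d3 br act \<phi> x y z w" for x y z w
  proof -
    have "\<phi> y (br x z) w = - \<phi> (br x z) y w" "\<phi> x (br y z) w = - \<phi> (br y z) x w"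
      "\<phi> y z (br x w) = \<phi> (br x w) y z" "\<phi> x z (br y w) = \<phi> (br y w) x z"
      "\<phi> x y (br z w) = \<phi> (br z w) x y"
      using s by (metis minus_minus)+
    then show ?thesis
      by (simp only: leib_d3_def CE_d3_def diff_minus_eq_add add_uminus_conv_diff)
  qed
  then have "leib_d3 \<phi> = CE_d3 br act \<phi>"
    by (simp add: fun_eq_iff)
  moreover have "\<phi> x y z + \<phi> y x z = 0" "\<phi> x y z + \<phi> x z y = 0" for x y z
    using s(1)[of y x z] s(2)[of x z y] by simp_all
  moreover have "trilinear_map scg scm \<phi>"
    using assms by (simp add: CE_C3_def)
  ultimately show ?thesis
    using assms C2.subspace_0[OF subspace_bilinear]
    by (simp add: ZL3_iff CE_Z3_def act_simps)
qed

lemma Z3_imp_zero_pair_in_ZL3: "\<phi> \<in> Z3 \<Longrightarrow> (0, \<phi>) \<in> Z"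
  using zero_pair_in_ZL3_iff by (simp add: CE_Z3_def)

text \<open>The symmetrization of \<open>f\<close> vanishes, and moving brackets into the first slot
  of \<open>f\<close> produces the signs of \<open>CE_d2\<close>.\<close>

lemma cobound_alternating:
  assumes "f \<in> C2"
  shows "cobound f = (0, CE_d2 br act f)"
proof -
  have b: "bilinear_map scg scg scm f" and a: "\<And>x. f x x = 0"
    using assms by (auto simp: CE_C2_def)
  have skew: "f y x = - f x y" for x y
    by (rule bilinear_alternating_skew[OF b a])
  have "leib_d2 f x y z = CE_d2 br act f x y z" for x y z
    using skew[of y "br x z"] skew[of x "br y z"] by (simp add: leib_d2_def CE_d2_def)
  moreover have "f x y + f y x = 0" for x y
    using skew[of x y] by simp
  ultimately show ?thesis
    by (simp add: cobound_def fun_eq_iff)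
qed

lemma subspace_CE_C2: "C2.subspace C2"
  by (rule C2.subspaceI)
    (auto simp: CE_C2_def bilinear_iff fun_scale_def M.scale_right_distrib algebra_simps)

lemma subspace_CE_B3: "C3.subspace B3"
proof (rule C3.subspaceI)
  \<comment> \<open>On alternating cochains \<open>CE_d2\<close> is a component of
    \<open>cobound\<close> and inherits its linearity.\<close>
  have d2: "CE_d2 br act f = snd (cobound f)" if "f \<in> C2" for f
    using cobound_alternating[OF that] by simp
  have "CE_d2 br act 0 = 0"
    by (simp add: CE_d2_def fun_eq_iff act_simps)
  then show "0 \<in> B3"
    using C2.subspace_0[OF subspace_CE_C2] by (force simp: CE_B3_def)
  show "p + q \<in> B3" if pq: "p \<in> B3" "q \<in> B3" for p q
  proof -
    obtain f g where fg: "f \<in> C2" "g \<in> C2" "p = snd (cobound f)" "q = snd (cobound g)"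
      using pq d2 by (auto simp: CE_B3_def)
    have s: "f + g \<in> C2"
      using C2.subspace_add[OF subspace_CE_C2] fg by blast
    then have "p + q = CE_d2 br act (f + g)"
      using fg by (simp add: d2 cobound_add)
    with s show ?thesis by (simp add: CE_B3_def)
  qed
  show "scale3 c p \<in> B3" if p: "p \<in> B3" for c p
  proof -
    obtain f where f: "f \<in> C2" "p = snd (cobound f)"
      using p d2 by (auto simp: CE_B3_def)
    have s: "scale2 c f \<in> C2"
      using C2.subspace_scale[OF subspace_CE_C2] f by blast
    then have "scale3 c p = CE_d2 br act (scale2 c f)"
      using f by (simp add: d2 cobound_scale prod_scale_def)
    with s show ?thesis by (simp add: CE_B3_def)
  qed
qed

lemma subspace_CE_C3: "C3.subspace (CE_C3 scg scm)"
  by (rule C3.subspaceI)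
    (auto simp: CE_C3_def trilinear_iff fun_scale_def M.scale_right_distrib algebra_simps)

lemma subspace_CE_Z3: "C3.subspace Z3"
proof -
  \<comment> \<open>This exhibits \<open>Z3\<close> as a preimage of the subspace \<open>Z\<close>
    under a linear map.\<close>
  have "Z3 = {\<phi> \<in> CE_C3 scg scm. (0, \<phi>) \<in> Z}"
    using zero_pair_in_ZL3_iff by (auto simp: CE_Z3_def)
  moreover have "(0, \<phi> + \<psi>) \<in> Z" if "(0, \<phi>) \<in> Z" "(0, \<psi>) \<in> Z" for \<phi> \<psi>
    using L.subspace_add[OF subspace_ZL3 that] by simp
  moreover have "(0, scale3 c \<phi>) \<in> Z" if "(0, \<phi>) \<in> Z" for \<phi> c
    using L.subspace_scale[OF subspace_ZL3 that, of c] by (simp add: prod_scale_def)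
  moreover have "(0, 0) \<in> Z"
    using L.subspace_0[OF subspace_ZL3] by (simp add: zero_prod_def)
  ultimately show ?thesis
    using subspace_CE_C3 by (simp add: C3.subspace_def)
qed

section \<open>Skew-symmetrization as a linear map on pairs\<close>

definition skew_symmetrize ::
    "('g \<Rightarrow> 'g \<Rightarrow> 'm) \<times> ('g \<Rightarrow> 'g \<Rightarrow> 'g \<Rightarrow> 'm) \<Rightarrow> 'g \<Rightarrow> 'g \<Rightarrow> 'g \<Rightarrow> 'm" where
  "skew_symmetrize p = jbar br scm (fst p) (snd p)"

lemma jbar_expand:
  "jbar br scm s j x y z =
    scm (1 / 6) (j x y z + j y z x + j z x y - j y x z - j x z y - j z y x) -
    scm (1 / 12) (s (br x y) z + s (br y z) x + s (br z x) y
      - s (br y x) z - s (br x z) y - s (br z y) x)"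
  by (simp add: jbar_def alt_sum3_expand[OF M.vector_space_axioms])

lemma skew_symmetrize_add:
  "skew_symmetrize (p + q) = skew_symmetrize p + skew_symmetrize q"
  by (simp add: skew_symmetrize_def jbar_expand fun_eq_iff M.scale_right_distrib
      M.scale_right_diff_distrib)

lemma skew_symmetrize_scale:
  "skew_symmetrize (prod_scale scale2 scale3 c p) = scale3 c (skew_symmetrize p)"
  by (simp add: skew_symmetrize_def jbar_expand fun_scale_def prod_scale_def fun_eq_iff
      M.scale_right_distrib M.scale_right_diff_distrib mult.commute)

end

section \<open>Characteristic other than 2 and 3: decomposition of cocycles\<close>

locale lie_representation_char_not_2_3 = lie_representation scg br scm act
  for scg :: "'k::field \<Rightarrow> 'g::ab_group_add \<Rightarrow> 'g"
    and br :: "'g \<Rightarrow> 'g \<Rightarrow> 'g"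
    and scm :: "'k \<Rightarrow> 'm::ab_group_add \<Rightarrow> 'm"
    and act :: "'g \<Rightarrow> 'm \<Rightarrow> 'm" +
  assumes char_not_2: "CHAR('k) \<noteq> 2" and char_not_3: "CHAR('k) \<noteq> 3"
begin

text \<open>A prime that vanishes in the field is a multiple of the characteristic, hence equal to
  it.\<close>

lemma two_neq_0: "(2 :: 'k) \<noteq> 0" and three_neq_0: "(3 :: 'k) \<noteq> 0"
proof -
  have d: "CHAR('k) = p" if "of_nat p = (0 :: 'k)" "prime p" for p
  proof -
    have "CHAR('k) dvd p"
      using that(1) by (simp add: of_nat_eq_0_iff_char_dvd)
    then show ?thesis
      using that(2) by (auto simp: prime_nat_iff)
  qed
  show "(2 :: 'k) \<noteq> 0"
    using d[of 2] char_not_2 by auto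
  show "(3 :: 'k) \<noteq> 0"
    using d[of 3] char_not_3 by auto
qed

lemma six_neq_0: "(6 :: 'k) \<noteq> 0"
proof -
  have "(6 :: 'k) = 2 * 3" by simp
  then show ?thesis using two_neq_0 three_neq_0 by (metis mult_eq_0_iff)
qed

text \<open>The common form of all halvings below: \<open>c = 1\<close> for 1/2,
  \<open>c = 2\<close> for 1/4, and \<open>c = 6\<close> to compare 1/12 with 1/6.\<close>

lemma scale_double: "scm (1 / (2 * c)) (m + m) = scm (1 / c) m"
proof -
  have "m + m = scm 2 m"
    using M.scale_left_distrib[of 1 1 m] by simp
  then show ?thesis
    using two_neq_0 by simp
qed

lemma eq_uminus_imp_0: "(m :: 'm) = - m \<Longrightarrow> m = 0"
  using scale_double[of 1 m] by (metis M.scale_one M.scale_zero_right div_by_1 add.right_inverse)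

text \<open>The six signed terms of an alternating map coincide, and the factor 1/6 cancels their
  number; the terms in \<open>s\<close> only involve values on brackets.\<close>

lemma skew_symmetrize_alternating:
  assumes "\<phi> \<in> CE_C3 scg scm" and "\<And>x y z. s (br x y) z = 0"
  shows "skew_symmetrize (s, \<phi>) = \<phi>"
proof -
  note sk = CE_C3_skew[OF assms(1)]
  have "skew_symmetrize (s, \<phi>) x y z = \<phi> x y z" for x y z
  proof -
    have p: "\<phi> y z x = \<phi> x y z" "\<phi> z x y = \<phi> x y z" "\<phi> y x z = - \<phi> x y z"
      "\<phi> x z y = - \<phi> x y z" "\<phi> z y x = - \<phi> x y z"
      using sk by (metis minus_minus)+
    have "scm 1 m + scm 1 m + scm 1 m + scm 1 m + scm 1 m + scm 1 m = scm 6 m" for m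
      unfolding M.scale_left_distrib[symmetric] by simp
    then show ?thesis
      using six_neq_0 by (simp add: skew_symmetrize_def jbar_expand assms(2) p)
  qed
  then show ?thesis by (simp add: fun_eq_iff)
qed

text \<open>In the alternating sum of \<open>leib_d2 f\<close> the action terms cancel by symmetry
  of \<open>f\<close>, and the three bracket terms contribute \<open>- A\<close>, \<open>A\<close>
  and \<open>A\<close>. The first component of \<open>cobound f\<close> is twice \<open>f\<close>
  and contributes \<open>A + A\<close>, so the result is \<open>A/6 - 2A/12 = 0\<close>. This
  explains the constant 1/12.\<close>

lemma skew_symmetrize_cobound_symmetric:
  assumes "bilinear_map scg scg scm f" and sym: "\<And>x y. f x y = f y x"
  shows "skew_symmetrize (cobound f) = 0"
proof -
  have "skew_symmetrize (cobound f) x y z = 0" for x y z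
  proof -
    define A where "A = f (br x y) z + f (br y z) x + f (br z x) y
      - f (br y x) z - f (br x z) y - f (br z y) x"
    note a = br_anti[of y x] br_anti[of z x] br_anti[of z y]
    have "leib_d2 f x y z + leib_d2 f y z x + leib_d2 f z x y
        - leib_d2 f y x z - leib_d2 f x z y - leib_d2 f z y x = A"
      unfolding leib_d2_def A_def
      using sym[of y x] sym[of z x] sym[of z y] sym[of x "br y z"] sym[of y "br x z"]
        sym[of z "br x y"]
      by (simp add: a bilinear_simps[OF assms(1)] act_simps algebra_simps)
    moreover have "skew_symmetrize (cobound f) x y z = scm (1 / 6)
        (leib_d2 f x y z + leib_d2 f y z x + leib_d2 f z x y
          - leib_d2 f y x z - leib_d2 f x z y - leib_d2 f z y x) - scm (1 / 12) (A + A)"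
      unfolding skew_symmetrize_def jbar_expand cobound_def A_def
      by (simp add: sym[of _ "br _ _"] algebra_simps)
    ultimately show ?thesis
      using scale_double[of 6 A] by simp
  qed
  then show ?thesis by (simp add: fun_eq_iff)
qed

text \<open>Each symmetry condition is played against skewness of \<open>s\<close>. The sum
  \<open>j x y z + j y x z\<close> is symmetric in \<open>x\<close> and \<open>y\<close>, so
  \<open>act z (s x y)\<close> equals its own negative; so does \<open>s (br x y) z\<close>. The
  right-hand sides of both conditions on \<open>j\<close> then vanish, which makes \<open>j\<close>
  skew and, 2 being invertible, alternating.\<close>

lemma ZL3_skew:
  assumes Z: "(s, j) \<in> Z" and skew: "\<And>x y. s y x = - s x y"
  shows "s (br x y) z = 0" "s z (br x y) = 0" "j \<in> Z3" "(s, 0) \<in> Z"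
    "skew_symmetrize (s, j) = j"
proof -
  have bil: "bilinear_map scg scg scm s" and tri: "trilinear_map scg scm j"
    and j1: "j x y z + j y x z = act z (s x y)"
    and j2: "j x y z + j x z y = act x (s y z) - s (br x y) z - s y (br x z)"
    and sb: "s (br x y) z = s z (br x y)" for x y z
    using Z by (auto simp: ZL3_iff)
  have act0: "act z (s x y) = 0" for x y z
  proof (rule eq_uminus_imp_0)
    show "act z (s x y) = - act z (s x y)"
      using j1[of x y z] j1[of y x z] skew[of x y] by (simp add: act_simps add.commute)
  qed
  have s1: "s (br x y) z = 0" for x y z
    by (rule eq_uminus_imp_0) (use sb[of x y z] skew[of z "br x y"] in simp)
  then have s2: "s z (br x y) = 0" for x y z
    using sb by metis
  show "s (br x y) z = 0" "s z (br x y) = 0"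
    using s1 s2 by auto
  have sk: "j y x z = - j x y z" "j x z y = - j x y z" for x y z
    using j1[of x y z] j2[of x y z] act0 s1 s2
    by (simp_all add: eq_neg_iff_add_eq_0 add.commute)
  have "j x x z = 0" "j x z z = 0" for x z
    using sk(1)[of x x z] sk(2)[of x z z] eq_uminus_imp_0 by blast+
  moreover from this have "j x y x = 0" for x y
    using sk(2)[of x y x] by simp
  ultimately have C3: "j \<in> CE_C3 scg scm"
    using tri by (simp add: CE_C3_def)
  show "(s, 0) \<in> Z"
    using bil act0 s1 s2 C3.subspace_0[OF subspace_trilinear]
    by (simp add: ZL3_iff leib_d3_def fun_eq_iff act_simps)
  \<comment> \<open>Subtracting the cocycle \<open>(s, 0)\<close> isolates \<open>j\<close>.\<close>
  from L.subspace_diff[OF subspace_ZL3 Z this] have "(0, j) \<in> Z"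
    by simp
  then show "j \<in> Z3"
    using zero_pair_in_ZL3_iff[OF C3] by simp
  show "skew_symmetrize (s, j) = j"
    using skew_symmetrize_alternating[OF C3] s1 by blast
qed

lemma ZL3_decomposition:
  assumes "p \<in> Z"
  obtains f s where "bilinear_map scg scg scm f"
    "\<And>x y. s y x = - s x y" "(s, skew_symmetrize p) \<in> Z"
    "p = cobound f + (s, skew_symmetrize p)"
proof -
  obtain t j where p: "p = (t, j)" by (cases p)
  have t: "bilinear_map scg scg scm t"
    using assms by (simp add: p ZL3_iff)
  \<comment> \<open>The factor 1/4 makes \<open>f x y + f y x\<close> the symmetric part of
    \<open>t\<close>, so that what remains is skew.\<close>
  define f where "f = (\<lambda>x y. scm (1 / (2 * 2)) (t x y + t y x))"
  define s where "s = (\<lambda>x y. t x y - (f x y + f y x))"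
  have f: "bilinear_map scg scg scm f"
    using t by (simp add: bilinear_iff f_def M.scale_right_distrib algebra_simps)
  have sym: "f x y = f y x" for x y
    by (simp add: f_def add.commute)
  have half: "f x y + f y x = scm (1 / 2) (t x y + t y x)" for x y
  proof -
    have "f x y + f y x = scm (1 / (2 * 2)) ((t x y + t y x) + (t x y + t y x))"
      unfolding sym[of y x] by (simp only: f_def M.scale_right_distrib)
    then show ?thesis
      by (simp only: scale_double)
  qed
  have skew: "s y x = - s x y" for x y
  proof -
    have "scm (1 / 2) (t x y + t y x) + scm (1 / 2) (t x y + t y x) = t x y + t y x"
      using scale_double[of 1 "t x y + t y x"] by (simp add: M.scale_right_distrib)
    then show ?thesis
      unfolding s_def half by (simp add: add.commute algebra_simps)
  qed
  have eq: "p = cobound f + (s, j - leib_d2 f)"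
    by (simp add: p cobound_def s_def fun_eq_iff)
  then have Z: "(s, j - leib_d2 f) \<in> Z"
    using L.subspace_diff[OF subspace_ZL3 assms cobound_in_ZL3[OF f]] by simp
  \<comment> \<open>Skew-symmetrization kills \<open>cobound f\<close> and returns the second
    component of the rest, by \<open>ZL3_skew\<close>.\<close>
  have "skew_symmetrize p = j - leib_d2 f"
    unfolding eq skew_symmetrize_add skew_symmetrize_cobound_symmetric[OF f sym]
    using ZL3_skew(5)[OF Z skew] by simp
  then show thesis
    using that[OF f skew] eq Z by simp
qed

text \<open>No differential is computed: the decomposition shows \<open>skew_symmetrize p\<close> as
  the second component of a cocycle whose first component is skew.\<close>

lemma skew_symmetrize_Z3:
  assumes "p \<in> Z"
  shows "skew_symmetrize p \<in> Z3"
  using ZL3_decomposition[OF assms] ZL3_skew(3) by metis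

text \<open>The Chevalley-Eilenberg differential squares to zero here because the pair
  \<open>(0, CE_d2 br act f)\<close> is a Leibniz coboundary, hence a cocycle.\<close>

lemma CE_d2_in_Z3:
  assumes "f \<in> C2"
  shows "CE_d2 br act f \<in> Z3"
proof -
  have "bilinear_map scg scg scm f"
    using assms by (simp add: CE_C2_def)
  then have "(0, CE_d2 br act f) \<in> Z"
    using cobound_in_ZL3 cobound_alternating[OF assms] by metis
  then show ?thesis
    by (rule ZL3_skew(3)) simp
qed

lemma CE_B3_subset_Z3: "B3 \<subseteq> Z3"
  using CE_d2_in_Z3 by (auto simp: CE_B3_def)

lemma skew_symmetrize_zero_pair:
  assumes "\<phi> \<in> Z3"
  shows "skew_symmetrize (0, \<phi>) = \<phi>"
  using assms skew_symmetrize_alternating by (auto simp: CE_Z3_def)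

lemma zero_pair_in_BL3:
  assumes "\<phi> \<in> B3"
  shows "(0, \<phi>) \<in> B"
proof -
  obtain f where f: "f \<in> C2" "\<phi> = CE_d2 br act f"
    using assms by (auto simp: CE_B3_def)
  then have "(0, \<phi>) = cobound f"
    by (simp add: cobound_alternating)
  then show ?thesis
    using f by (simp add: BL3_eq CE_C2_def)
qed

text \<open>Split \<open>f\<close> into its symmetric half \<open>fs\<close>, which contributes 0,
  and its alternating half \<open>fa\<close>, whose coboundary is already alternating and is left
  unchanged.\<close>

lemma skew_symmetrize_BL3:
  assumes "p \<in> B"
  shows "skew_symmetrize p \<in> B3"
proof -
  obtain f where f: "bilinear_map scg scg scm f" "p = cobound f"
    using assms by (auto simp: BL3_eq)
  define fs where "fs = (\<lambda>x y. scm (1 / 2) (f x y + f y x))"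
  define fa where "fa = (\<lambda>x y. scm (1 / 2) (f x y - f y x))"
  have fs: "bilinear_map scg scg scm fs" "\<And>x y. fs x y = fs y x"
    using f(1) by (auto simp: bilinear_iff fs_def M.scale_right_distrib algebra_simps)
  have fa: "fa \<in> C2"
    using f(1) by (auto simp: CE_C2_def bilinear_iff fa_def M.scale_right_distrib
        M.scale_right_diff_distrib algebra_simps)
  have "fs x y + fa x y = f x y" for x y
  proof -
    have "fs x y + fa x y = scm (1 / 2) (f x y + f x y)"
      unfolding fs_def fa_def M.scale_right_distrib[symmetric] by (simp add: algebra_simps)
    then show ?thesis
      using scale_double[of 1 "f x y"] by simp
  qed
  then have "f = fs + fa"
    by (simp add: fun_eq_iff)
  then have "skew_symmetrize p = CE_d2 br act fa"
    using skew_symmetrize_zero_pair[OF CE_d2_in_Z3[OF fa]]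
    by (simp add: f(2) cobound_add skew_symmetrize_add
        skew_symmetrize_cobound_symmetric[OF fs] cobound_alternating[OF fa])
  then show ?thesis
    using fa by (simp add: CE_B3_def)
qed

section \<open>The exact sequence\<close>

sublocale ss: quotient_map "prod_scale scale2 scale3" scale3 Z B Z3 B3 skew_symmetrize
  by unfold_locales
    (use subspace_ZL3 subspace_BL3 BL3_subset_ZL3 subspace_CE_B3 skew_symmetrize_BL3
        skew_symmetrize_Z3 in \<open>auto simp: linear_on_def skew_symmetrize_add skew_symmetrize_scale\<close>)

sublocale splitting: quotient_map scale3 "prod_scale scale2 scale3" Z3 B3 Z B "Pair 0"
  by unfold_locales
    (use subspace_CE_Z3 subspace_CE_B3 CE_B3_subset_Z3 subspace_BL3 zero_pair_in_BL3
        Z3_imp_zero_pair_in_ZL3 in \<open>auto simp: linear_on_def prod_scale_def\<close>)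

lemma ss_eq: "ss scg br scm act = induced (\<lambda>p. skew_symmetrize p +o B3)"
  by (simp add: ss_def skew_symmetrize_def CE_class_def case_prod_unfold)

lemma splitting_eq: "splitting scg br scm act = induced (\<lambda>\<phi>. (0, \<phi>) +o B)"
  by (simp add: splitting_def HL3_class_def)

lemma jbar_in_CE_Z3: "(s, j) \<in> Z \<Longrightarrow> jbar br scm s j \<in> Z3"
  using skew_symmetrize_Z3[of "(s, j)"] by (simp add: skew_symmetrize_def)

lemma ss_class:
  "(s, j) \<in> Z \<Longrightarrow> ss scg br scm act (HL3_class scg br scm act (s, j)) =
    CE_class scg br scm act (jbar br scm s j)"
  using ss.induced_coset[of "(s, j)"]
  by (simp add: ss_eq HL3_class_def CE_class_def skew_symmetrize_def)

lemma splitting_class: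
  "\<phi> \<in> Z3 \<Longrightarrow> splitting scg br scm act (CE_class scg br scm act \<phi>) =
    HL3_class scg br scm act (0, \<phi>)"
  using splitting.induced_coset[of \<phi>] by (simp add: splitting_eq HL3_class_def CE_class_def)

lemma linear_on_ss:
  "linear_on (HL3_scale scg br scm act) (CE_scale scg br scm act)
     (HL3 scg br scm act) (CE_H3 scg br scm act) (ss scg br scm act)"
  using ss.linear_on_induced by (simp add: ss_eq HL3_scale_def CE_scale_def HL3_def CE_H3_def)

lemma linear_on_splitting:
  "linear_on (CE_scale scg br scm act) (HL3_scale scg br scm act)
     (CE_H3 scg br scm act) (HL3 scg br scm act) (splitting scg br scm act)"
  using splitting.linear_on_induced
  by (simp add: splitting_eq HL3_scale_def CE_scale_def HL3_def CE_H3_def)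

lemma ss_splitting:
  assumes "C \<in> CE_H3 scg br scm act"
  shows "ss scg br scm act (splitting scg br scm act C) = C"
proof -
  obtain \<phi> where \<phi>: "\<phi> \<in> Z3" "C = CE_class scg br scm act \<phi>"
    using assms by (auto simp: CE_H3_def quot_def CE_class_def)
  then show ?thesis
    using splitting_class ss_class[OF Z3_imp_zero_pair_in_ZL3] skew_symmetrize_zero_pair
    by (simp add: skew_symmetrize_def)
qed

text \<open>Surjectivity comes from the right inverse \<open>splitting\<close>.\<close>

lemma image_ss: "ss scg br scm act ` HL3 scg br scm act = CE_H3 scg br scm act"
proof -
  have "ss scg br scm act C \<in> CE_H3 scg br scm act" if "C \<in> HL3 scg br scm act" for C
    using linear_on_ss that by (simp add: linear_on_def)
  moreover have "splitting scg br scm act C \<in> HL3 scg br scm act"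
    if "C \<in> CE_H3 scg br scm act" for C
    using linear_on_splitting that by (simp add: linear_on_def)
  ultimately show ?thesis
    using ss_splitting by (auto simp: image_iff) metis
qed

section \<open>The map \<open>iota\<close>: injectivity and image\<close>

lemma ab_cases:
  assumes "X \<in> ab scg br"
  obtains x where "X = ab_proj scg br x"
  using assms by (auto simp: ab_def quot_def ab_proj_def)

lemma ab_pullback_skew:
  assumes "a \<in> linear_wedge2_ab scg br scm"
  shows "ab_pullback scg br a y x = - ab_pullback scg br a x y"
  by (rule bilinear_alternating_skew[OF ab_pullback_linear[OF assms]])
    (use assms in \<open>simp add: ab_pullback_def linear_wedge2_ab_def ab_proj_in_ab\<close>)

lemma ab_pullback_in_ZL3:
  "a \<in> Hom_wedge2_ab scg br scm act \<Longrightarrow> (ab_pullback scg br a, 0) \<in> Z"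
  using wedge2_ab_in_ZL3_iff by (auto simp: Hom_wedge2_ab_def)

lemma linear_on_iota:
  "linear_on scale2 (HL3_scale scg br scm act)
    (Hom_wedge2_ab scg br scm act) (HL3 scg br scm act) (iota scg br scm act)"
  unfolding linear_on_def
proof (intro conjI ballI allI)
  show "iota scg br scm act a \<in> HL3 scg br scm act" if "a \<in> Hom_wedge2_ab scg br scm act" for a
    using ab_pullback_in_ZL3[OF that] by (auto simp: iota_def HL3_class_def HL3_def quot_def)
  show "iota scg br scm act (a + b) = iota scg br scm act a + iota scg br scm act b" for a b
  proof -
    have "(ab_pullback scg br (a + b), 0 :: 'g \<Rightarrow> 'g \<Rightarrow> 'g \<Rightarrow> 'm) =
        (ab_pullback scg br a, 0) + (ab_pullback scg br b, 0)"
      by (simp add: ab_pullback_def fun_eq_iff)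
    then show ?thesis
      using L.coset_add[OF subspace_BL3] by (simp only: iota_def HL3_class_def)
  qed
  show "iota scg br scm act (scale2 c a) = HL3_scale scg br scm act c (iota scg br scm act a)"
    for c a
  proof -
    have "(ab_pullback scg br (scale2 c a), 0 :: 'g \<Rightarrow> 'g \<Rightarrow> 'g \<Rightarrow> 'm) =
        prod_scale scale2 scale3 c (ab_pullback scg br a, 0)"
      by (simp add: ab_pullback_def fun_eq_iff prod_scale_def fun_scale_def)
    then show ?thesis
      using L.coset_scale[OF subspace_BL3] by (simp only: iota_def HL3_class_def HL3_scale_def)
  qed
qed

text \<open>The first component of a coboundary is symmetric, while \<open>ab_pullback scg br a\<close> is skew.\<close>

lemma inj_on_iota: "inj_on (iota scg br scm act) (Hom_wedge2_ab scg br scm act)"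
proof (rule inj_onI)
  fix a b assume ab: "a \<in> Hom_wedge2_ab scg br scm act" "b \<in> Hom_wedge2_ab scg br scm act"
    and eq: "iota scg br scm act a = iota scg br scm act b"
  have lin: "a \<in> linear_wedge2_ab scg br scm" "b \<in> linear_wedge2_ab scg br scm"
    using ab by (auto simp: Hom_wedge2_ab_def)
  have "(ab_pullback scg br a, 0) - (ab_pullback scg br b, 0) \<in> B"
    using eq by (simp add: iota_def HL3_class_def L.coset_eq_iff[OF subspace_BL3])
  then obtain f where f: "ab_pullback scg br a - ab_pullback scg br b = (\<lambda>x y. f x y + f y x)"
    by (auto simp: BL3_eq cobound_def)
  have pull: "ab_pullback scg br a x y = ab_pullback scg br b x y" for x y
  proof -
    let ?d = "\<lambda>x y. ab_pullback scg br a x y - ab_pullback scg br b x y"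
    have "?d x y = ?d y x"
      using fun_cong[OF fun_cong[OF f]] by (simp add: add.commute)
    also have "\<dots> = - ?d x y"
      using ab_pullback_skew[OF lin(1), of x y] ab_pullback_skew[OF lin(2), of x y] by simp
    finally have "?d x y = 0"
      by (rule eq_uminus_imp_0)
    then show ?thesis by simp
  qed
  \<comment> \<open>Off the carrier both maps take the default value 0, so agreement on projections
    suffices.\<close>
  have "a X Y = b X Y" for X Y
  proof (cases "X \<in> ab scg br \<and> Y \<in> ab scg br")
    case True
    then show ?thesis
      using pull by (auto simp: ab_pullback_def elim!: ab_cases)
  next
    case False
    then show ?thesis
      using lin by (auto simp: linear_wedge2_ab_def)
  qed
  then show "a = b" by blast
qed

text \<open>By span induction \<open>s\<close> vanishes as soon as one argument lies in the derived
  algebra, so its values depend only on cosets and any choice of representatives will do.\<close>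

lemma factor_through_ab:
  assumes bil: "bilinear_map scg scg scm s" and alt: "\<And>x. s x x = 0"
    and br: "\<And>x y z. s (br x y) z = 0" "\<And>x y z. s z (br x y) = 0"
  obtains a where "a \<in> linear_wedge2_ab scg br scm" "ab_pullback scg br a = s"
proof -
  define rep where "rep X = (SOME x. X = ab_proj scg br x)" for X
  define a where "a X Y = (if X \<in> ab scg br \<and> Y \<in> ab scg br then s (rep X) (rep Y) else 0)"
    for X Y
  have s0: "s u z = 0 \<and> s z u = 0" if "u \<in> derived scg br" for u z
    using that unfolding derived_def
  proof (induction rule: span_induct)
    case base
    then show ?case
      by (simp add: subspace_def bilinear_simps[OF bil])
  next
    case (step u)
    then show ?case using br by auto
  qed
  have rep: "rep (ab_proj scg br x) - x \<in> derived scg br" for x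
  proof -
    have "ab_proj scg br x = ab_proj scg br (rep (ab_proj scg br x))"
      unfolding rep_def by (rule someI) (rule refl)
    then show ?thesis
      using coset_eq_iff[OF subspace_derived] unfolding ab_proj_def by metis
  qed
  have a: "a (ab_proj scg br x) (ab_proj scg br y) = s x y" for x y
  proof -
    let ?x = "rep (ab_proj scg br x)" and ?y = "rep (ab_proj scg br y)"
    \<comment> \<open>One argument is changed at a time, each by an element of the derived
      algebra.\<close>
    have "s ?x ?y - s x y = s (?x - x) ?y + s x (?y - y)"
      by (simp add: bilinear_simps[OF bil])
    also have "\<dots> = 0"
      using s0[OF rep] by simp
    finally show ?thesis
      by (simp add: a_def ab_proj_in_ab)
  qed
  \<comment> \<open>Every coset in the carrier is a projection, where \<open>a\<close> is given by
    \<open>s\<close>; off the carrier \<open>a\<close> is 0 by definition.\<close>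
  have "a \<in> linear_wedge2_ab scg br scm"
    unfolding linear_wedge2_ab_def mem_Collect_eq linear_on_def
    by (intro conjI ballI allI impI)
      (auto simp: a alt bilinear_simps[OF bil] simp flip: ab_proj_add ab_proj_scale
        elim!: ab_cases, auto simp: a_def)
  moreover have "ab_pullback scg br a = s"
    by (simp add: ab_pullback_def a fun_eq_iff)
  ultimately show thesis by (rule that)
qed

text \<open>The kernel is written with \<open>B3\<close>, the zero of the quotient. If
  \<open>ss\<close> kills the class of \<open>p\<close>, the alternating part in the decomposition
  of \<open>p\<close> is a coboundary, so \<open>p\<close> is cohomologous to \<open>(s, 0)\<close>
  with \<open>s\<close> skew, and \<open>s\<close> comes from the abelianization.\<close>

lemma image_iota:
  "iota scg br scm act ` Hom_wedge2_ab scg br scm act =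
    {C \<in> HL3 scg br scm act. ss scg br scm act C = B3}"
proof (intro equalityI subsetI)
  fix C assume "C \<in> iota scg br scm act ` Hom_wedge2_ab scg br scm act"
  then obtain a where a: "a \<in> Hom_wedge2_ab scg br scm act" "C = iota scg br scm act a"
    by blast
  have lin: "a \<in> linear_wedge2_ab scg br scm"
    using a by (simp add: Hom_wedge2_ab_def)
  \<comment> \<open>The pullback is skew, so skew-symmetrizing returns the second component
    0.\<close>
  have "skew_symmetrize (ab_pullback scg br a, 0) = 0"
    by (rule ZL3_skew(5)[OF ab_pullback_in_ZL3[OF a(1)] ab_pullback_skew[OF lin]])
  then have "ss scg br scm act C = 0 +o B3"
    using ss_class[OF ab_pullback_in_ZL3[OF a(1)]]
    by (simp add: a(2) iota_def CE_class_def skew_symmetrize_def)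
  moreover have "C \<in> HL3 scg br scm act"
    using a linear_on_iota by (simp add: linear_on_def)
  ultimately show "C \<in> {C \<in> HL3 scg br scm act. ss scg br scm act C = B3}"
    by (simp add: set_zero_plus)
next
  fix C assume C: "C \<in> {C \<in> HL3 scg br scm act. ss scg br scm act C = B3}"
  then obtain p where p: "p \<in> Z" "C = p +o B"
    by (auto simp: HL3_def quot_def)
  from ZL3_decomposition[OF p(1)] obtain f s where
    f: "bilinear_map scg scg scm f" and skew: "\<And>x y. s y x = - s x y"
    and Z: "(s, skew_symmetrize p) \<in> Z" and dec: "p = cobound f + (s, skew_symmetrize p)"
    by metis
  have "skew_symmetrize p +o B3 = B3"
    using C p ss.induced_coset by (simp add: ss_eq)
  then have "(0, skew_symmetrize p) \<in> B"
    using C3.coset_eq_self_iff[OF subspace_CE_B3] zero_pair_in_BL3 by simp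
  moreover have "cobound f \<in> B"
    using f by (simp add: BL3_eq)
  moreover have "p - (s, 0) = cobound f + (0, skew_symmetrize p)"
    by (subst dec) (simp add: cobound_def)
  ultimately have "p - (s, 0) \<in> B"
    using L.subspace_add[OF subspace_BL3] by simp
  then have C_eq: "C = HL3_class scg br scm act (s, 0)"
    using p(2) by (simp add: HL3_class_def L.coset_eq_iff[OF subspace_BL3])
  have bil: "bilinear_map scg scg scm s"
    using Z by (simp add: ZL3_iff)
  have "s x x = 0" for x
    by (rule eq_uminus_imp_0[OF skew])
  then obtain a where a: "a \<in> linear_wedge2_ab scg br scm" "ab_pullback scg br a = s"
    using factor_through_ab[OF bil] ZL3_skew(1,2)[OF Z skew] by metis
  \<comment> \<open>Equivariance of \<open>a\<close> is equivalent to \<open>(s, 0)\<close> being a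
    cocycle.\<close>
  then have "a \<in> Hom_wedge2_ab scg br scm act"
    using wedge2_ab_in_ZL3_iff[OF a(1)] ZL3_skew(4)[OF Z skew] by simp
  then show "C \<in> iota scg br scm act ` Hom_wedge2_ab scg br scm act"
    using a(2) C_eq by (auto simp: iota_def)
qed

end

theorem theorem4p7:
  fixes scg :: "'k::field \<Rightarrow> 'g::ab_group_add \<Rightarrow> 'g"
    and br :: "'g \<Rightarrow> 'g \<Rightarrow> 'g"
    and scm :: "'k \<Rightarrow> 'm::ab_group_add \<Rightarrow> 'm"
    and act :: "'g \<Rightarrow> 'm \<Rightarrow> 'm"
  assumes "CHAR('k) \<noteq> 2" and "CHAR('k) \<noteq> 3"
    and "lie_representation scg br scm act"
  shows
    \<comment> \<open>\<open>ss\<close> is a well-defined linear map induced by skew-symmetrization\<close>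
    "(\<forall>s j. (s, j) \<in> ZL3 scg br scm act \<longrightarrow>
        jbar br scm s j \<in> CE_Z3 scg br scm act \<and>
        ss scg br scm act (HL3_class scg br scm act (s, j)) =
          CE_class scg br scm act (jbar br scm s j)) \<and>
     linear_on (HL3_scale scg br scm act) (CE_scale scg br scm act)
       (HL3 scg br scm act) (CE_H3 scg br scm act) (ss scg br scm act) \<and>
     \<comment> \<open>\<open>\<iota>\<close> is a well-defined linear map\<close>
     (\<forall>a \<in> Hom_wedge2_ab scg br scm act. (ab_pullback scg br a, 0) \<in> ZL3 scg br scm act) \<and>
     linear_on (fun_scale (fun_scale scm)) (HL3_scale scg br scm act)
       (Hom_wedge2_ab scg br scm act) (HL3 scg br scm act) (iota scg br scm act) \<and>
     \<comment> \<open>exactness\<close>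
     inj_on (iota scg br scm act) (Hom_wedge2_ab scg br scm act) \<and>
     iota scg br scm act ` Hom_wedge2_ab scg br scm act =
       {C \<in> HL3 scg br scm act. ss scg br scm act C = CE_B3 scg br scm act} \<and>
     ss scg br scm act ` HL3 scg br scm act = CE_H3 scg br scm act \<and>
     \<comment> \<open>the splitting\<close>
     (\<forall>\<phi> \<in> CE_Z3 scg br scm act.
        (0, \<phi>) \<in> ZL3 scg br scm act \<and>
        splitting scg br scm act (CE_class scg br scm act \<phi>) = HL3_class scg br scm act (0, \<phi>)) \<and>
     linear_on (CE_scale scg br scm act) (HL3_scale scg br scm act)
       (CE_H3 scg br scm act) (HL3 scg br scm act) (splitting scg br scm act) \<and>
     (\<forall>C \<in> CE_H3 scg br scm act. ss scg br scm act (splitting scg br scm act C) = C)"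
proof -
  interpret lie_representation_char_not_2_3 scg br scm act
    using assms by (simp add: lie_representation_char_not_2_3_def
        lie_representation_char_not_2_3_axioms_def)
  show ?thesis
    by (intro conjI allI ballI impI)
      (erule jbar_in_CE_Z3 ss_class ab_pullback_in_ZL3 Z3_imp_zero_pair_in_ZL3
        splitting_class ss_splitting | rule linear_on_ss linear_on_iota inj_on_iota image_iota
        image_ss linear_on_splitting)+
qed

end
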